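(* Assume that the nonlinear matrix pencil $\iota(\lambda)=\sum_{k\ge0}\iota_k\lambda^k$, with radius of convergence $R>0$ and $\iota_0$ invertible, possesses a unique smallest (in modulus) spectral value $\lambda_0$, with $|\lambda_0|<R$. In particular, $\iota(\lambda)^{-1}$ is analytic in $\{|\lambda|<|\lambda_0|+\delta,\ \lambda\ne\lambda_0\}$ for some $\delta>0$. Then the associated inverse power iteration $$\underline{u}_{k+1}=\mathcal{A}\underline{u}_k,$$ defined on $\ell^p_\rho$ with $1\le p\le\infty$ and $|\lambda_0|<\rho<R$, converges for initial vectors $\underline{u}_0$ in the complement $V$ of a strict subspace of $\ell^p_\rho$ to eigenvalue and eigenvector in the sense that $$\underline{u}_k/|\underline{u}_k|\to\underline{u}_*,\qquad \mathcal{A}\underline{u}_*=\lambda_0^{-1}\underline{u}_*,\qquad \iota(\lambda_0)(\underline{u}_* )_1=0.$$ In particular, $V$ contains sequences $\underline{u}$ with $\underline{u}_j=0$ for $j\ge2$ and $\underline{u}_1\in V_0$, the complement of a strict subspace of $\mathbb{C}^N$.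
   Context: Here $\iota_k\in\mathbb{C}^{N\times N}$ and $\iota(\lambda)=\sum_{k\ge0}\iota_k\lambda^k$ converges for $|\lambda|<R$. A point $\lambda_1$ is a spectral value of $\iota$ if $\lambda\mapsto\iota(\lambda)^{-1}$ is not analytic at $\lambda_1$. The operator $\mathcal{A}$ acts on sequences $\underline{u}=(u_j)_{j\ge1}$, $u_j\in\mathbb{C}^N$, by $$(\mathcal{A}\underline{u})_1=-\iota_0^{-1}\sum_{k\ge1}\iota_ku_k,\qquad(\mathcal{A}\underline{u})_j=u_{j-1}\ \text{ for }j>1.$$ For $\rho>0$, $\ell^p_\rho$ is the space of sequences $(u_j)_{j\ge1}$ in $\mathbb{C}^N$ with $(u_j\rho^{-j})_j\in\ell^p$, and $|\underline{u}|$ denotes its norm $\|(u_j\rho^{-j})_j\|_{\ell^p}$.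
   Formalization: The convergence u_k/|u_k| → u_* is proved in the form (λ_0/|λ_0|)^k u_k/|u_k| → u_*, since without this phase factor it fails unless λ_0 > 0 (e.g. N=1, ι(λ)=1+λ); for λ_0 > 0 the factor is 1. *)

theory Defs
  imports "HOL-Analysis.Analysis" "HOL-Library.Function_Algebras"
begin

text \<open>Componentwise rendering of \<open>\<Sum>k. iota\<^sub>k z^k\<close>; only meaningful for \<open>\<bar>z\<bar> < conv_radius iota\<close>.\<close>

definition pencil :: "(nat \<Rightarrow> complex^'n^'n) \<Rightarrow> complex \<Rightarrow> complex^'n^'n" where
  "pencil iota z = (\<chi> i j. \<Sum>k. iota k $ i $ j * z ^ k)"

text \<open>Invertibility is required explicitly because \<^const>\<open>matrix_inv\<close> is total and has
  an unspecified value at singular matrices.\<close>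

definition pencil_inv_analytic_on :: "(nat \<Rightarrow> complex^'n^'n) \<Rightarrow> complex set \<Rightarrow> bool" where
  "pencil_inv_analytic_on iota S \<longleftrightarrow>
     (\<forall>z\<in>S. invertible (pencil iota z)) \<and>
     (\<forall>i j. (\<lambda>z. matrix_inv (pencil iota z) $ i $ j) analytic_on S)"

definition spectral_value :: "(nat \<Rightarrow> complex^'n^'n) \<Rightarrow> complex \<Rightarrow> bool" where
  "spectral_value iota z \<longleftrightarrow>
     ereal (cmod z) < conv_radius iota \<and> \<not> pencil_inv_analytic_on iota {z}"

text \<open>A sequence \<open>(u\<^sub>j)\<close>, \<open>j \<ge> 1\<close>, is a function on \<^typ>\<open>nat\<close> whose unused value at index 0 is
  fixed to be 0.\<close>

definition companion_op ::
    "(nat \<Rightarrow> complex^'n^'n) \<Rightarrow> (nat \<Rightarrow> complex^'n) \<Rightarrow> nat \<Rightarrow> complex^'n" where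
  "companion_op iota u j =
     (if j = 0 then 0
      else if j = 1 then - (matrix_inv (iota 0) *v (\<Sum>k. iota (Suc k) *v u (Suc k)))
      else u (j - 1))"

definition lp_space :: "ereal \<Rightarrow> real \<Rightarrow> (nat \<Rightarrow> complex^'n) set" where
  "lp_space p \<rho> = {u. u 0 = 0 \<and>
     (if p = \<infinity> then bdd_above ((\<lambda>j. norm (u j) / \<rho> ^ j) ` {1..})
      else (\<lambda>j. (norm (u j) / \<rho> ^ j) powr real_of_ereal p) summable_on {1..})}"

definition lp_norm :: "ereal \<Rightarrow> real \<Rightarrow> (nat \<Rightarrow> complex^'n) \<Rightarrow> real" where
  "lp_norm p \<rho> u =
     (if p = \<infinity> then (SUP j\<in>{1..}. norm (u j) / \<rho> ^ j)
      else (\<Sum>\<^sub>\<infinity>j\<in>{1..}. (norm (u j) / \<rho> ^ j) powr real_of_ereal p) powr (1 / real_of_ereal p))"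

text \<open>Addition, subtraction and zero of sequences are the pointwise ones of
  \<^theory>\<open>HOL-Library.Function_Algebras\<close>; the following supplies the complex scaling.\<close>

definition seq_scale :: "complex \<Rightarrow> (nat \<Rightarrow> complex^'n) \<Rightarrow> nat \<Rightarrow> complex^'n" where
  "seq_scale c u = (\<lambda>j. c *s u j)"

global_interpretation cseq: vector_space seq_scale
  by unfold_locales
    (auto simp: seq_scale_def fun_eq_iff vector_add_ldistrib vector_sadd_rdistrib)

text \<open>The power iteration for \<^const>\<open>companion_op\<close> has dominant eigenvalue \<open>1 / lam0\<close>. Unless
  \<open>lam0 > 0\<close>, the phase of the normalised iterates rotates like \<open>(\<bar>lam0\<bar> / lam0)^k\<close>, so they
  converge only up to a unimodular factor. The factor \<open>sgn lam0 ^ k\<close> in the theorem removes this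
  rotation; it is 1 if \<open>lam0 > 0\<close>.\<close>

end

theory Submission
  imports Defs "HOL-Complex_Analysis.Complex_Analysis" "HOL-Real_Asymp.Real_Asymp"
begin

text \<open>
The idea is to read the power iteration as a linear recurrence and to find its asymptotics from the
generating function. The companion operator \<open>A\<close> shifts a sequence and computes a new first entry, so
the iterates are determined by the first entries \<open>y\<^sub>k = (A^k u)\<^sub>1\<close>, \<open>k \<ge> 1\<close>. These satisfy
\<open>\<Sum>i<k. \<iota>\<^sub>i y\<^sub>k\<^sub>-\<^sub>i = - f\<^sub>k\<close>, where \<open>f\<^sub>k = \<Sum>j. \<iota>\<^sub>k\<^sub>+\<^sub>j u\<^sub>j\<^sub>+\<^sub>1\<close> depends on the initial sequence only. With
\<open>Y(z) = \<Sum>k. y\<^sub>k z^k\<close> and \<open>F(z) = \<Sum>k. f\<^sub>k z^k\<close> this reads \<open>\<iota>(z) Y(z) = - F(z)\<close>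
(\<open>pencil_mult_iterate_fps\<close>), and \<open>F\<close> converges for \<open>\<bar>z\<bar> < \<rho>\<close>.

The inverse of the pencil has a pole at \<open>\<lambda>\<^sub>0\<close> of some order \<open>m \<ge> 1\<close> and is otherwise analytic in a
slightly larger disc. Hence \<open>G(z) = (z - \<lambda>\<^sub>0)^m \<iota>(z)^-1\<close> extends analytically to this disc with
\<open>G(\<lambda>\<^sub>0) \<noteq> 0\<close> (\<open>pole_of_inverse\<close>), and \<open>(z - \<lambda>\<^sub>0)^m Y(z) = - G(z) F(z)\<close>. Comparing coefficients shows
that \<open>\<lambda>\<^sub>0^k y\<^sub>k\<close>, divided by the coefficient of \<open>z^k\<close> in \<open>(1 - z)^(-m)\<close>, tends to
\<open>L u = - (- \<lambda>\<^sub>0)^(-m) G(\<lambda>\<^sub>0) F(\<lambda>\<^sub>0)\<close> (\<open>companion_iterates_asymptotics\<close>). A pole of higher order only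
contributes a positive factor of polynomial growth, which the normalisation removes.

By the shift structure, the whole iterate with the same scaling converges in \<open>\<ell>\<^sup>p\<^sub>\<rho>\<close> to the geometric
sequence \<open>(\<lambda>\<^sub>0^(j - 1) L u)\<^sub>j\<close> (\<open>companion_iterates_lp_limit\<close>). Normalising is continuous away from 0, so
if \<open>L u \<noteq> 0\<close> the normalised iterates converge after removal of the phase of \<open>\<lambda>\<^sub>0^k\<close>. The limit is an
eigensequence because \<open>\<iota>(\<lambda>\<^sub>0) G(\<lambda>\<^sub>0) = 0\<close>. The exceptional subspace is the kernel of \<open>L\<close>. It is proper:
on sequences \<open>(v, 0, 0, ...)\<close> one has \<open>F(\<lambda>\<^sub>0) = (\<iota>(\<lambda>\<^sub>0) - \<iota>\<^sub>0) v\<close>, and \<open>G(\<lambda>\<^sub>0) \<iota>(\<lambda>\<^sub>0) = 0\<close>, so \<open>L\<close> is a nonzero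
multiple of \<open>G(\<lambda>\<^sub>0) \<iota>\<^sub>0 v\<close> there, which is not zero for all \<open>v\<close> since \<open>\<iota>\<^sub>0\<close> is invertible.
\<close>

(* The dollar sign is reserved for vector components here. *)
unbundle no Formal_Power_Series.fps_syntax

section \<open>Weighted sequence spaces\<close>

text \<open>Convexity of \<open>x powr p\<close> up to the endpoint 0, where the entries of a sequence may well lie. At the
endpoint the inequality degenerates to \<open>t powr p \<le> t\<close> for \<open>0 \<le> t \<le> 1\<close>.\<close>

lemma powr_convex_nonneg:
  fixes x y t p :: real
  assumes "1 \<le> p" "0 \<le> x" "0 \<le> y" "0 \<le> t" "t \<le> 1"
  shows "((1 - t) * x + t * y) powr p \<le> (1 - t) * x powr p + t * y powr p"
proof -
  have shrink: "(s * z) powr p \<le> s * z powr p" if "0 \<le> s" "s \<le> 1" "0 \<le> z" for s z :: real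
  proof -
    have "s powr p \<le> s"
      using that assms(1) powr_mono'[of 1 p s] by (cases "s = 0") auto
    then show ?thesis
      using that by (simp add: powr_mult mult_right_mono)
  qed
  show ?thesis
  proof (cases "x = 0 \<or> y = 0")
    case True
    then show ?thesis
      using shrink[of t y] shrink[of "1 - t" x] assms by auto
  next
    case False
    then show ?thesis
      using convex_onD[OF powr_convex[OF assms(1)], of t x y] assms by auto
  qed
qed

lemma weighted_nonneg:
  fixes u :: "nat \<Rightarrow> complex^'n"
  shows "0 < \<rho> \<Longrightarrow> 0 \<le> norm (u j) / \<rho> ^ j"
  by simp

lemma lp_norm_nonneg:
  assumes "0 < \<rho>" "u \<in> lp_space p \<rho>"
  shows "0 \<le> lp_norm p \<rho> u"
proof (cases "p = \<infinity>")
  case True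
  have "norm (u 1) / \<rho> ^ 1 \<le> (SUP j\<in>{1..}. norm (u j) / \<rho> ^ j)"
    using assms True by (intro cSUP_upper) (auto simp: lp_space_def)
  then show ?thesis
    using True weighted_nonneg[OF assms(1), of u 1] by (simp add: lp_norm_def)
qed (simp add: lp_norm_def)

lemma lp_space_components_summable:
  assumes "p \<noteq> \<infinity>" "u \<in> lp_space p \<rho>"
  shows "(\<lambda>j. (norm (u j) / \<rho> ^ j) powr real_of_ereal p) summable_on {1..}"
  using assms by (simp add: lp_space_def)

lemma real_of_ereal_ge_1:
  assumes "1 \<le> p" "p \<noteq> \<infinity>"
  shows "1 \<le> real_of_ereal p"
  using assms by (cases p) auto

lemma norm_le_lp_norm:
  assumes "0 < \<rho>" "1 \<le> p" "u \<in> lp_space p \<rho>"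
  shows "norm (u j) \<le> lp_norm p \<rho> u * \<rho> ^ j"
proof (cases "j = 0")
  case True
  then show ?thesis
    using assms lp_norm_nonneg[OF assms(1,3)] by (simp add: lp_space_def)
next
  case False
  have "norm (u j) / \<rho> ^ j \<le> lp_norm p \<rho> u"
  proof (cases "p = \<infinity>")
    case True
    then show ?thesis
      using assms False by (auto simp: lp_space_def lp_norm_def intro!: cSUP_upper)
  next
    case pf: False
    let ?q = "real_of_ereal p"
    let ?f = "\<lambda>j. (norm (u j) / \<rho> ^ j) powr ?q"
    have q: "1 \<le> ?q"
      using assms(2) pf by (rule real_of_ereal_ge_1)
    have "infsum ?f {j} \<le> infsum ?f {1..}"
      using False by (intro infsum_mono_neutral lp_space_components_summable[OF pf assms(3)]) auto
    then have "?f j powr (1 / ?q) \<le> infsum ?f {1..} powr (1 / ?q)"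
      using q by (intro powr_mono2) auto
    moreover have "?f j powr (1 / ?q) = norm (u j) / \<rho> ^ j"
      using q assms(1) by (simp add: powr_powr)
    ultimately show ?thesis
      using pf by (simp add: lp_norm_def)
  qed
  then show ?thesis
    using assms(1) by (simp add: field_simps)
qed

lemma lp_norm_eq_0_imp:
  assumes "0 < \<rho>" "1 \<le> p" "u \<in> lp_space p \<rho>" "lp_norm p \<rho> u = 0"
  shows "u = 0"
  using norm_le_lp_norm[OF assms(1-3)] assms(4) by (auto simp: fun_eq_iff)

lemma lp_space_zero: "0 \<in> lp_space p \<rho>"
  by (auto simp: lp_space_def intro: bdd_aboveI2[where M=0])

text \<open>For \<open>p < \<infinity>\<close> a bound on all finite partial sums of nonnegative terms gives summability and bounds the
sum, so membership and norm estimates reduce to finite sums here and below.\<close>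

lemma lp_norm_leI:
  assumes "0 < \<rho>" "1 \<le> p" "0 \<le> C" "u 0 = 0"
    and "p = \<infinity> \<Longrightarrow> \<forall>j\<ge>1. norm (u j) / \<rho> ^ j \<le> C"
    and "p \<noteq> \<infinity> \<Longrightarrow> \<forall>F. finite F \<longrightarrow> F \<subseteq> {1..} \<longrightarrow>
      (\<Sum>j\<in>F. (norm (u j) / \<rho> ^ j) powr real_of_ereal p) \<le> C powr real_of_ereal p"
  shows "u \<in> lp_space p \<rho>" and "lp_norm p \<rho> u \<le> C"
proof -
  have "u \<in> lp_space p \<rho> \<and> lp_norm p \<rho> u \<le> C"
  proof (cases "p = \<infinity>")
    case True
    then show ?thesis
      using assms by (auto simp: lp_space_def lp_norm_def intro!: bdd_aboveI2[where M=C] cSUP_least)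
  next
    case False
    let ?q = "real_of_ereal p"
    let ?f = "\<lambda>j. (norm (u j) / \<rho> ^ j) powr ?q"
    have q: "1 \<le> ?q"
      using assms(2) False by (rule real_of_ereal_ge_1)
    have summ: "?f summable_on {1..}"
      using assms(6)[OF False]
      by (intro nonneg_bdd_above_summable_on bdd_aboveI2[where M="C powr ?q"]) auto
    have "infsum ?f {1..} \<le> C powr ?q"
      using assms(6)[OF False] by (intro infsum_le_finite_sums[OF summ]) auto
    then have "infsum ?f {1..} powr (1 / ?q) \<le> (C powr ?q) powr (1 / ?q)"
      using q by (intro powr_mono2 infsum_nonneg) auto
    also have "\<dots> = C"
      using q assms(3) by (simp add: powr_powr)
    finally show ?thesis
      using False summ assms(4) by (simp add: lp_space_def lp_norm_def)
  qed
  then show "u \<in> lp_space p \<rho>" "lp_norm p \<rho> u \<le> C"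
    by auto
qed

lemma lp_finite_sum_le:
  assumes "0 < \<rho>" "1 \<le> p" "p \<noteq> \<infinity>" "u \<in> lp_space p \<rho>" "finite F" "F \<subseteq> {1..}"
  shows "(\<Sum>j\<in>F. (norm (u j) / \<rho> ^ j) powr real_of_ereal p) \<le> lp_norm p \<rho> u powr real_of_ereal p"
proof -
  let ?q = "real_of_ereal p"
  let ?f = "\<lambda>j. (norm (u j) / \<rho> ^ j) powr ?q"
  have q: "1 \<le> ?q"
    using assms(2,3) by (rule real_of_ereal_ge_1)
  have "sum ?f F \<le> infsum ?f {1..}"
    using assms by (intro finite_sum_le_infsum lp_space_components_summable) auto
  also have "\<dots> = lp_norm p \<rho> u powr ?q"
    using q assms(3) by (auto simp: lp_norm_def powr_powr infsum_nonneg)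
  finally show ?thesis .
qed

text \<open>Minkowski's inequality. Dividing by the sum of the two norms makes each entry of \<open>u + v\<close> a convex
combination of entries of the normalised sequences, so convexity of the \<open>p\<close>-th power suffices and
Hoelder's inequality is avoided.\<close>

lemma lp_add:
  assumes "0 < \<rho>" "1 \<le> p" "u \<in> lp_space p \<rho>" "v \<in> lp_space p \<rho>"
  shows "u + v \<in> lp_space p \<rho>" and "lp_norm p \<rho> (u + v) \<le> lp_norm p \<rho> u + lp_norm p \<rho> v"
proof -
  let ?A = "lp_norm p \<rho> u" and ?B = "lp_norm p \<rho> v" and ?q = "real_of_ereal p"
  have nn: "0 \<le> ?A" "0 \<le> ?B"
    using assms lp_norm_nonneg by auto
  have "u + v \<in> lp_space p \<rho> \<and> lp_norm p \<rho> (u + v) \<le> ?A + ?B"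
  proof (cases "?A = 0 \<or> ?B = 0")
    case True
    then have "u = 0 \<or> v = 0"
      using assms lp_norm_eq_0_imp by blast
    then show ?thesis
      using assms nn by auto
  next
    case False
    then have pos: "0 < ?A" "0 < ?B"
      using nn by auto
    have tri: "norm ((u + v) j) / \<rho> ^ j \<le> norm (u j) / \<rho> ^ j + norm (v j) / \<rho> ^ j" for j
      using assms(1) norm_triangle_ineq[of "u j" "v j"]
      by (simp add: divide_right_mono flip: add_divide_distrib)
    have inf: "norm ((u + v) j) / \<rho> ^ j \<le> ?A + ?B" for j
      using tri[of j] norm_le_lp_norm[OF assms(1-3), of j]
        norm_le_lp_norm[OF assms(1,2,4), of j] assms(1)
      by (smt (verit) pos_divide_le_eq zero_less_power)
    have fin: "(\<Sum>j\<in>F. (norm ((u + v) j) / \<rho> ^ j) powr ?q) \<le> (?A + ?B) powr ?q"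
      if "p \<noteq> \<infinity>" "finite F" "F \<subseteq> {1..}" for F
    proof -
      have q: "1 \<le> ?q"
        using assms(2) that(1) by (rule real_of_ereal_ge_1)
      \<comment> \<open>\<open>(a + b) / (A + B)\<close> is the convex combination of \<open>a / A\<close> and \<open>b / B\<close> with weight \<open>t\<close>.\<close>
      define t where "t = ?B / (?A + ?B)"
      have t: "0 \<le> t" "t \<le> 1" "1 - t = ?A / (?A + ?B)"
        using pos by (auto simp: t_def field_simps)
      let ?a = "\<lambda>j. norm (u j) / \<rho> ^ j" and ?b = "\<lambda>j. norm (v j) / \<rho> ^ j"
      have "(norm ((u + v) j) / \<rho> ^ j) powr ?q
          \<le> (?A + ?B) powr ?q * ((1 - t) * (?a j powr ?q / ?A powr ?q) + t * (?b j powr ?q / ?B powr ?q))"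
        for j
      proof -
        have "(norm ((u + v) j) / \<rho> ^ j) powr ?q \<le> (?a j + ?b j) powr ?q"
          using tri[of j] q assms(1) by (intro powr_mono2) auto
        also have "?a j + ?b j = (?A + ?B) * ((1 - t) * (?a j / ?A) + t * (?b j / ?B))"
          unfolding t(3) using pos by (simp add: t_def add_divide_distrib distrib_left)
        also have "\<dots> powr ?q = (?A + ?B) powr ?q * ((1 - t) * (?a j / ?A) + t * (?b j / ?B)) powr ?q"
          by (rule powr_mult)
        also have "\<dots> \<le> (?A + ?B) powr ?q *
            ((1 - t) * (?a j / ?A) powr ?q + t * (?b j / ?B) powr ?q)"
          using pos t q assms(1) by (intro mult_left_mono powr_convex_nonneg) auto
        finally show ?thesis
          by (simp only: powr_divide)
      qed
      then have "(\<Sum>j\<in>F. (norm ((u + v) j) / \<rho> ^ j) powr ?q) \<le> (\<Sum>j\<in>F.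
         (?A + ?B) powr ?q * ((1 - t) * (?a j powr ?q / ?A powr ?q) + t * (?b j powr ?q / ?B powr ?q)))"
        by (intro sum_mono)
      also have "\<dots> = (?A + ?B) powr ?q * ((1 - t) * ((\<Sum>j\<in>F. ?a j powr ?q) / ?A powr ?q)
          + t * ((\<Sum>j\<in>F. ?b j powr ?q) / ?B powr ?q))"
        by (simp only: sum_distrib_left sum_divide_distrib sum.distrib distrib_left)
      also have "\<dots> \<le> (?A + ?B) powr ?q * ((1 - t) * 1 + t * 1)"
        using lp_finite_sum_le[OF assms(1,2) that(1) assms(3) that(2,3)]
          lp_finite_sum_le[OF assms(1,2) that(1) assms(4) that(2,3)] t pos
        by (intro mult_left_mono add_mono) auto
      finally show ?thesis
        by simp
    qed
    show ?thesis
      using lp_norm_leI[OF assms(1,2), of "?A + ?B" "u + v"] inf fin nn assms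
      by (auto simp: lp_space_def)
  qed
  then show "u + v \<in> lp_space p \<rho>" "lp_norm p \<rho> (u + v) \<le> ?A + ?B"
    by auto
qed

lemma norm_vector_scalar_mult:
  fixes v :: "complex^'n"
  shows "norm (c *s v) = norm c * norm v"
  by (simp add: norm_vec_def L2_set_right_distrib norm_mult)

text \<open>The inequality is applied to \<open>c\<close> and to \<open>inverse c\<close>; together they give the equality that follows.\<close>

lemma lp_scale_le:
  assumes "0 < \<rho>" "1 \<le> p" "u \<in> lp_space p \<rho>"
  shows "seq_scale c u \<in> lp_space p \<rho>" and "lp_norm p \<rho> (seq_scale c u) \<le> norm c * lp_norm p \<rho> u"
proof -
  let ?A = "lp_norm p \<rho> u" and ?q = "real_of_ereal p"
  have nn: "0 \<le> ?A"
    using assms lp_norm_nonneg by auto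
  have inf: "norm (seq_scale c u j) / \<rho> ^ j \<le> norm c * ?A" for j
    using norm_le_lp_norm[OF assms, of j] assms(1)
    by (simp add: seq_scale_def norm_vector_scalar_mult divide_le_eq mult.assoc mult_left_mono)
  have fin: "(\<Sum>j\<in>F. (norm (seq_scale c u j) / \<rho> ^ j) powr ?q) \<le> (norm c * ?A) powr ?q"
    if "p \<noteq> \<infinity>" "finite F" "F \<subseteq> {1..}" for F
  proof -
    have "(\<Sum>j\<in>F. (norm (seq_scale c u j) / \<rho> ^ j) powr ?q)
        = norm c powr ?q * (\<Sum>j\<in>F. (norm (u j) / \<rho> ^ j) powr ?q)"
      using assms(1) by (simp add: seq_scale_def norm_vector_scalar_mult sum_distrib_left
          powr_mult flip: times_divide_eq_right)
    also have "\<dots> \<le> norm c powr ?q * ?A powr ?q"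
      using lp_finite_sum_le[OF assms(1,2) that(1) assms(3) that(2,3)] by (intro mult_left_mono) auto
    finally show ?thesis
      using nn by (simp add: powr_mult)
  qed
  show "seq_scale c u \<in> lp_space p \<rho>" "lp_norm p \<rho> (seq_scale c u) \<le> norm c * ?A"
    using lp_norm_leI[OF assms(1,2), of "norm c * ?A" "seq_scale c u"] inf fin nn assms(3)
    by (auto simp: lp_space_def seq_scale_def)
qed

lemma lp_norm_scale:
  assumes "0 < \<rho>" "1 \<le> p" "u \<in> lp_space p \<rho>"
  shows "lp_norm p \<rho> (seq_scale c u) = norm c * lp_norm p \<rho> u"
proof (cases "c = 0")
  case True
  then show ?thesis
    using lp_scale_le[OF assms, of c] lp_norm_nonneg[OF assms(1), of "seq_scale c u" p] by auto
next
  case False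
  have "lp_norm p \<rho> u = lp_norm p \<rho> (seq_scale (inverse c) (seq_scale c u))"
    using False by (simp add: seq_scale_def)
  also have "\<dots> \<le> norm (inverse c) * lp_norm p \<rho> (seq_scale c u)"
    by (intro lp_scale_le assms)
  finally have "norm c * lp_norm p \<rho> u \<le> lp_norm p \<rho> (seq_scale c u)"
    using False by (simp add: norm_divide field_simps)
  then show ?thesis
    using lp_scale_le(2)[OF assms, of c] by auto
qed

lemma lp_diff:
  assumes "0 < \<rho>" "1 \<le> p" "u \<in> lp_space p \<rho>" "v \<in> lp_space p \<rho>"
  shows "u - v \<in> lp_space p \<rho>" and "\<bar>lp_norm p \<rho> u - lp_norm p \<rho> v\<bar> \<le> lp_norm p \<rho> (u - v)"
proof -
  have neg: "a - b = a + seq_scale (-1) b" for a b :: "nat \<Rightarrow> complex^'n"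
    by (simp add: seq_scale_def fun_eq_iff vector_sneg_minus1[symmetric])
  show mem: "u - v \<in> lp_space p \<rho>"
    unfolding neg by (intro lp_add lp_scale_le assms)
  have "lp_norm p \<rho> ((u - v) + v) \<le> lp_norm p \<rho> (u - v) + lp_norm p \<rho> v"
    by (intro lp_add assms mem)
  moreover have "lp_norm p \<rho> (u + seq_scale (-1) (u - v))
      \<le> lp_norm p \<rho> u + lp_norm p \<rho> (seq_scale (-1) (u - v))"
    by (intro lp_add assms lp_scale_le mem)
  moreover have "u + seq_scale (-1) (u - v) = v"
    by (simp add: neg[symmetric])
  ultimately show "\<bar>lp_norm p \<rho> u - lp_norm p \<rho> v\<bar> \<le> lp_norm p \<rho> (u - v)"
    using lp_norm_scale[OF assms(1,2) mem, of "-1"] by simp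
qed

text \<open>With \<open>N\<close> the \<open>\<ell>\<^sup>1\<close> norm, every entry is at most \<open>N\<close>, hence its \<open>p\<close>-th power is at most \<open>N powr (p - 1)\<close>
times the entry. This reduces convergence in all \<open>\<ell>\<^sup>p\<close> norms to convergence in the \<open>\<ell>\<^sup>1\<close> norm.\<close>

lemma lp_norm_le_l1:
  assumes "0 < \<rho>" "1 \<le> p" "u 0 = 0" "summable (\<lambda>j. norm (u j) / \<rho> ^ j)"
  shows "u \<in> lp_space p \<rho>" and "lp_norm p \<rho> u \<le> (\<Sum>j. norm (u j) / \<rho> ^ j)"
proof -
  let ?a = "\<lambda>j. norm (u j) / \<rho> ^ j" and ?q = "real_of_ereal p"
  let ?N = "suminf ?a"
  have le: "sum ?a F \<le> ?N" if "finite F" for F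
    using assms(1) by (intro sum_le_suminf assms(4) that) auto
  have nn: "0 \<le> ?N"
    using assms(1) by (intro suminf_nonneg assms(4)) auto
  have inf: "?a j \<le> ?N" for j
    using le[of "{j}"] by simp
  have fin: "(\<Sum>j\<in>F. ?a j powr ?q) \<le> ?N powr ?q" if "p \<noteq> \<infinity>" "finite F" "F \<subseteq> {1..}" for F
  proof (cases "?N = 0")
    case True
    then have "?a j = 0" for j
      using inf[of j] weighted_nonneg[OF assms(1), of u j] by linarith
    then have "\<And>j. u j = 0" using assms(1) by simp
    then show ?thesis
      by simp
  next
    case False
    have q: "1 \<le> ?q"
      using assms(2) that(1) by (rule real_of_ereal_ge_1)
    have "?a j powr ?q \<le> ?a j * ?N powr (?q - 1)" for j
    proof -
      have "?a j powr ?q = ?a j * ?a j powr (?q - 1)"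
        using assms(1) q powr_mult_base[of "?a j" "?q - 1"] by simp
      also have "\<dots> \<le> ?a j * ?N powr (?q - 1)"
        using inf[of j] q assms(1) by (intro mult_left_mono powr_mono2) auto
      finally show ?thesis .
    qed
    then have "(\<Sum>j\<in>F. ?a j powr ?q) \<le> (\<Sum>j\<in>F. ?a j * ?N powr (?q - 1))"
      by (intro sum_mono)
    also have "\<dots> = sum ?a F * ?N powr (?q - 1)"
      by (simp add: sum_distrib_right)
    also have "\<dots> \<le> ?N * ?N powr (?q - 1)"
      using le[OF that(2)] by (intro mult_right_mono) auto
    also have "\<dots> = ?N powr ?q"
      using nn powr_mult_base[of ?N "?q - 1"] by simp
    finally show ?thesis .
  qed
  show "u \<in> lp_space p \<rho>" "lp_norm p \<rho> u \<le> ?N"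
    using lp_norm_leI[of \<rho> p ?N u, OF assms(1,2) nn assms(3)] inf fin by auto
qed

definition seq_shift :: "nat \<Rightarrow> (nat \<Rightarrow> complex^'n) \<Rightarrow> nat \<Rightarrow> complex^'n" where
  "seq_shift k u j = (if k < j then u (j - k) else 0)"

lemma lp_shift:
  assumes "0 < \<rho>" "1 \<le> p" "u \<in> lp_space p \<rho>"
  shows "seq_shift k u \<in> lp_space p \<rho>" and "lp_norm p \<rho> (seq_shift k u) \<le> lp_norm p \<rho> u / \<rho> ^ k"
proof -
  let ?A = "lp_norm p \<rho> u" and ?q = "real_of_ereal p"
  let ?u' = "seq_shift k u"
  have nn: "0 \<le> ?A"
    using assms lp_norm_nonneg by auto
  have eq: "norm (?u' j) / \<rho> ^ j = (norm (u (j - k)) / \<rho> ^ (j - k)) / \<rho> ^ k" if "k < j" for j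
    using that by (simp add: seq_shift_def flip: power_add)
  have inf: "norm (?u' j) / \<rho> ^ j \<le> ?A / \<rho> ^ k" for j
  proof (cases "k < j")
    case True
    then show ?thesis
      unfolding eq[OF True] using norm_le_lp_norm[OF assms, of "j - k"] assms(1)
      by (intro divide_right_mono) (auto simp: divide_le_eq)
  qed (use nn assms(1) in \<open>simp add: seq_shift_def\<close>)
  have fin: "(\<Sum>j\<in>F. (norm (?u' j) / \<rho> ^ j) powr ?q) \<le> (?A / \<rho> ^ k) powr ?q"
    if "p \<noteq> \<infinity>" "finite F" "F \<subseteq> {1..}" for F
  proof -
    have "(\<Sum>j\<in>F. (norm (?u' j) / \<rho> ^ j) powr ?q)
        = (\<Sum>j\<in>{j\<in>F. k < j}. (norm (?u' j) / \<rho> ^ j) powr ?q)"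
      using that(2) by (intro sum.mono_neutral_right) (auto simp: seq_shift_def)
    also have "\<dots> = (\<Sum>j\<in>{j\<in>F. k < j}. (norm (u (j - k)) / \<rho> ^ (j - k)) powr ?q / (\<rho> ^ k) powr ?q)"
      by (intro sum.cong refl) (simp add: eq powr_divide del: divide_divide_eq_left)
    also have "\<dots> = (\<Sum>j\<in>(\<lambda>j. j - k) ` {j\<in>F. k < j}. (norm (u j) / \<rho> ^ j) powr ?q) / (\<rho> ^ k) powr ?q"
      by (subst sum.reindex) (auto simp: inj_on_def sum_divide_distrib)
    also have "\<dots> \<le> ?A powr ?q / (\<rho> ^ k) powr ?q"
      using that by (intro divide_right_mono lp_finite_sum_le[OF assms(1,2) that(1) assms(3)]) auto
    finally show ?thesis
      using assms(1) nn by (simp add: powr_divide)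
  qed
  show "?u' \<in> lp_space p \<rho>" "lp_norm p \<rho> ?u' \<le> ?A / \<rho> ^ k"
    using lp_norm_leI[OF assms(1,2), of "?A / \<rho> ^ k" ?u'] inf fin nn assms(1)
    by (auto simp: seq_shift_def)
qed


text \<open>Dominated convergence for the \<open>\<ell>\<^sup>1\<close> norm is Tannery's theorem; the \<open>\<ell>\<^sup>p\<close> norm is smaller.\<close>

lemma lp_norm_dominated_convergence:
  fixes t :: "nat \<Rightarrow> nat \<Rightarrow> complex^'n"
  assumes "0 < \<rho>" "1 \<le> p" "\<And>k. t k 0 = 0" "\<And>j. (\<lambda>k. t k j) \<longlonglongrightarrow> 0"
    and dom: "\<And>k j. norm (t k j) / \<rho> ^ j \<le> M j" and "summable M"
  shows "t k \<in> lp_space p \<rho>" and "(\<lambda>k. lp_norm p \<rho> (t k)) \<longlonglongrightarrow> 0"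
proof -
  have summ: "summable (\<lambda>j. norm (t k j) / \<rho> ^ j)" for k
    using assms(1) dom by (intro summable_comparison_test'[OF assms(6)]) auto
  show mem: "t k \<in> lp_space p \<rho>" for k
    by (rule lp_norm_le_l1[OF assms(1-3) summ])
  have "(\<lambda>k. \<Sum>j. norm (t k j) / \<rho> ^ j) \<longlonglongrightarrow> (\<Sum>j. 0)"
  proof (rule conjunct2[OF conjunct2[OF tannerys_theorem[where a="\<lambda>j k. norm (t k j) / \<rho> ^ j" and M=M]]])
    show "(\<lambda>k. norm (t k j) / \<rho> ^ j) \<longlonglongrightarrow> 0" for j
      using tendsto_divide_zero[OF tendsto_norm_zero[OF assms(4)[of j]]] by simp
    show "eventually (\<lambda>(j, k). norm (norm (t k j) / \<rho> ^ j) \<le> M j) (at_top \<times>\<^sub>F at_top)"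
      using assms(1) dom by (intro always_eventually) auto
  qed (use assms(6) in auto)
  then have lim: "(\<lambda>k. \<Sum>j. norm (t k j) / \<rho> ^ j) \<longlonglongrightarrow> 0"
    by simp
  show "(\<lambda>k. lp_norm p \<rho> (t k)) \<longlonglongrightarrow> 0"
    using lp_norm_nonneg[OF assms(1) mem] lp_norm_le_l1(2)[OF assms(1-3) summ]
    by (intro tendsto_sandwich[OF _ _ tendsto_const lim] always_eventually allI) auto
qed

text \<open>Normalisation is continuous away from 0: the difference of \<open>z / \<parallel>z\<parallel>\<close> and \<open>U / \<parallel>U\<parallel>\<close> splits
as \<open>(z - U) / \<parallel>z\<parallel> + (1 / \<parallel>z\<parallel> - 1 / \<parallel>U\<parallel>) U\<close>.\<close>

lemma lp_normalise_convergent: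
  assumes "0 < \<rho>" "1 \<le> p" "\<And>k. z k \<in> lp_space p \<rho>" "U \<in> lp_space p \<rho>" "U \<noteq> 0"
    and lim: "(\<lambda>k. lp_norm p \<rho> (z k - U)) \<longlonglongrightarrow> 0"
  shows "(\<lambda>k. lp_norm p \<rho> (seq_scale (1 / of_real (lp_norm p \<rho> (z k))) (z k)
      - seq_scale (1 / of_real (lp_norm p \<rho> U)) U)) \<longlonglongrightarrow> 0"
proof -
  let ?n = "\<lambda>k. lp_norm p \<rho> (z k)" and ?N = "lp_norm p \<rho> U"
  have N: "0 < ?N"
    using lp_norm_nonneg[OF assms(1,4)] lp_norm_eq_0_imp[OF assms(1,2,4)] assms(5) by linarith
  have "(\<lambda>k. ?n k - ?N) \<longlonglongrightarrow> 0"
    using lp_diff(2)[OF assms(1,2,3,4)] by (intro Lim_null_comparison[OF _ lim]) auto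
  then have nlim: "?n \<longlonglongrightarrow> ?N"
    by (rule LIM_zero_cancel)
  have "(\<lambda>k. norm (1 / ?n k) * lp_norm p \<rho> (z k - U) + norm (1 / ?n k - 1 / ?N) * ?N)
      \<longlonglongrightarrow> norm (1 / ?N) * 0 + norm (1 / ?N - 1 / ?N) * ?N"
    using N by (intro tendsto_intros nlim lim) auto
  then have bound: "(\<lambda>k. norm (1 / ?n k) * lp_norm p \<rho> (z k - U) + norm (1 / ?n k - 1 / ?N) * ?N) \<longlonglongrightarrow> 0"
    by simp
  have le: "lp_norm p \<rho> (seq_scale (1 / of_real (?n k)) (z k) - seq_scale (1 / of_real ?N) U)
      \<le> norm (1 / ?n k) * lp_norm p \<rho> (z k - U) + norm (1 / ?n k - 1 / ?N) * ?N"
    and mem: "seq_scale (1 / of_real (?n k)) (z k) - seq_scale (1 / of_real ?N) U \<in> lp_space p \<rho>" for k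
  proof -
    have eq: "seq_scale (1 / of_real (?n k)) (z k) - seq_scale (1 / of_real ?N) U
        = seq_scale (of_real (1 / ?n k)) (z k - U) + seq_scale (of_real (1 / ?n k - 1 / ?N)) U"
      by (simp add: seq_scale_def fun_eq_iff vec_eq_iff algebra_simps)
    note m = lp_scale_le(1)[OF assms(1,2) lp_diff(1)[OF assms(1,2) assms(3)[of k] assms(4)]] lp_scale_le(1)[OF assms(1,2,4)]
    show "seq_scale (1 / of_real (?n k)) (z k) - seq_scale (1 / of_real ?N) U \<in> lp_space p \<rho>"
      unfolding eq by (intro lp_add assms m)
    show "lp_norm p \<rho> (seq_scale (1 / of_real (?n k)) (z k) - seq_scale (1 / of_real ?N) U)
      \<le> norm (1 / ?n k) * lp_norm p \<rho> (z k - U) + norm (1 / ?n k - 1 / ?N) * ?N"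
      unfolding eq
      using lp_add(2)[OF assms(1,2) m(1)[where c="of_real (1 / ?n k)"] m(2)[where c="of_real (1 / ?n k - 1 / ?N)"]]
        lp_norm_scale[OF assms(1,2) lp_diff(1)[OF assms(1,2) assms(3)[of k] assms(4)], of "of_real (1 / ?n k)"]
        lp_norm_scale[OF assms(1,2,4), of "of_real (1 / ?n k - 1 / ?N)"]
      by (simp only: norm_of_real real_norm_def)
  qed
  show ?thesis
    using le lp_norm_nonneg[OF assms(1) mem]
    by (intro tendsto_sandwich[OF _ _ tendsto_const bound] always_eventually allI) auto
qed

section \<open>The pencil and the pole of its inverse\<close>

definition entry_fps :: "(nat \<Rightarrow> complex^'n^'n) \<Rightarrow> 'n \<Rightarrow> 'n \<Rightarrow> complex fps" where
  "entry_fps iota i j = Abs_fps (\<lambda>k. iota k $ i $ j)"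

lemma summable_norm_coeffs:
  fixes iota :: "nat \<Rightarrow> complex^'n^'n"
  assumes "0 \<le> r" "ereal r < conv_radius iota"
  shows "summable (\<lambda>k. norm (iota k) * r ^ k)"
  using abs_summable_in_conv_radius[of r "\<lambda>k. norm (iota k)"] assms by (simp add: abs_mult)

lemma norm_entry_le:
  fixes A :: "complex^'n^'n"
  shows "norm (A $ i $ j) \<le> norm A"
  using Finite_Cartesian_Product.norm_nth_le[of "A $ i" j] Finite_Cartesian_Product.norm_nth_le[of A i] by linarith

lemma conv_radius_le_entry_fps:
  fixes iota :: "nat \<Rightarrow> complex^'n^'n"
  shows "conv_radius iota \<le> fps_conv_radius (entry_fps iota i j)"
  unfolding fps_conv_radius_def
proof (rule conv_radius_geI_ex')
  fix r :: real
  assume r: "0 < r" "ereal r < conv_radius iota"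
  show "summable (\<lambda>n. fps_nth (entry_fps iota i j) n * complex_of_real r ^ n)"
    using r by (intro summable_comparison_test[OF _ summable_norm_coeffs[of r iota]])
      (auto simp: entry_fps_def norm_mult norm_power intro!: exI[of _ 0] mult_right_mono norm_entry_le)
qed

lemma pencil_entry: "pencil iota z $ i $ j = eval_fps (entry_fps iota i j) z"
  by (simp add: pencil_def eval_fps_def entry_fps_def)

lemma pencil_0: "pencil iota 0 = iota 0"
  by (simp add: vec_eq_iff pencil_entry eval_fps_at_0 entry_fps_def)

lemma pencil_entry_holomorphic:
  assumes "S \<subseteq> eball 0 (conv_radius iota)"
  shows "(\<lambda>z. pencil iota z $ i $ j) holomorphic_on S"
  unfolding pencil_entry
  by (rule holomorphic_on_eval_fps) (use assms conv_radius_le_entry_fps[of iota i j] eball_mono in blast)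

lemma det_holomorphic:
  fixes M :: "complex \<Rightarrow> complex^'n^'n"
  assumes "\<And>i j. (\<lambda>z. M z $ i $ j) holomorphic_on S"
  shows "(\<lambda>z. det (M z)) holomorphic_on S"
  unfolding det_def by (intro holomorphic_intros assms)

text \<open>The transposed cofactor matrix, written with the matrices that occur in Cramer's rule.\<close>

definition adjugate :: "complex^'n^'n \<Rightarrow> complex^'n^'n" where
  "adjugate A = (\<chi> k l. det (\<chi> i j. if j = k then axis l 1 $ i else A $ i $ j))"

lemma matrix_inv_props:
  fixes A :: "complex^'n^'n"
  assumes "invertible A"
  shows "A ** matrix_inv A = mat 1" and "matrix_inv A ** A = mat 1"
proof -
  have "A ** matrix_inv A = mat 1 \<and> matrix_inv A ** A = mat 1"
    using assms unfolding invertible_def matrix_inv_def by (rule someI_ex)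
  then show "A ** matrix_inv A = mat 1" "matrix_inv A ** A = mat 1"
    by auto
qed

lemma matrix_inv_adjugate:
  fixes A :: "complex^'n^'n"
  assumes "det A \<noteq> 0"
  shows "matrix_inv A $ k $ l = adjugate A $ k $ l / det A"
proof -
  have "A *v (matrix_inv A *v axis l 1) = axis l 1"
    using assms by (simp add: matrix_vector_mul_assoc matrix_inv_props invertible_det_nz)
  then have "(matrix_inv A *v axis l 1) $ k = adjugate A $ k $ l / det A"
    unfolding cramer[OF assms] by (simp add: adjugate_def)
  then show ?thesis
    by (simp add: matrix_vector_mult_def axis_def if_distrib cong: if_cong)
qed

lemma adjugate_holomorphic:
  fixes M :: "complex \<Rightarrow> complex^'n^'n"
  assumes "\<And>i j. (\<lambda>z. M z $ i $ j) holomorphic_on S"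
  shows "(\<lambda>z. adjugate (M z) $ k $ l) holomorphic_on S"
proof -
  have "(\<lambda>z. det (\<chi> i j. if j = k then axis l 1 $ i else M z $ i $ j)) holomorphic_on S"
  proof (rule det_holomorphic)
    show "(\<lambda>z. (\<chi> i j. if j = k then axis l 1 $ i else M z $ i $ j) $ i $ j) holomorphic_on S" for i j
      by (cases "j = k") (simp_all add: assms)
  qed
  then show ?thesis
    by (simp add: adjugate_def)
qed

lemma pencil_inv_analytic_onI:
  assumes "open S" "S \<subseteq> eball 0 (conv_radius iota)" "\<And>z. z \<in> S \<Longrightarrow> det (pencil iota z) \<noteq> 0"
  shows "pencil_inv_analytic_on iota S"
  unfolding pencil_inv_analytic_on_def
proof (intro conjI ballI allI)
  fix i j
  have "(\<lambda>z. adjugate (pencil iota z) $ i $ j / det (pencil iota z)) holomorphic_on S"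
    using assms(2,3)
    by (intro holomorphic_on_divide adjugate_holomorphic det_holomorphic pencil_entry_holomorphic)
  then show "(\<lambda>z. matrix_inv (pencil iota z) $ i $ j) analytic_on S"
    using assms(1,3) by (simp add: analytic_on_open matrix_inv_adjugate cong: holomorphic_cong)
qed (use assms(3) in \<open>auto simp: invertible_det_nz\<close>)

text \<open>The adjugate formula makes the inverse analytic wherever the determinant does not vanish, so inside
the disc of convergence the spectral values are the zeros of an analytic function.\<close>

lemma spectral_value_iff_det:
  "spectral_value iota z \<longleftrightarrow> ereal (cmod z) < conv_radius iota \<and> det (pencil iota z) = 0"
proof (cases "ereal (cmod z) < conv_radius iota \<and> det (pencil iota z) \<noteq> 0")
  case True
  let ?B = "eball 0 (conv_radius iota)"
  let ?S = "{w \<in> ?B. det (pencil iota w) \<noteq> 0}"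
  have "continuous_on ?B (\<lambda>w. det (pencil iota w))"
    by (intro holomorphic_on_imp_continuous_on det_holomorphic pencil_entry_holomorphic order_refl)
  then have "open (?B \<inter> (\<lambda>w. det (pencil iota w)) -` (- {0}))"
    by (intro continuous_open_preimage) auto
  moreover have "?B \<inter> (\<lambda>w. det (pencil iota w)) -` (- {0}) = ?S"
    by auto
  ultimately have "pencil_inv_analytic_on iota ?S"
    by (intro pencil_inv_analytic_onI) auto
  then have "pencil_inv_analytic_on iota {z}"
    using True by (auto simp: pencil_inv_analytic_on_def intro: analytic_on_subset[of _ ?S])
  then show ?thesis
    using True by (simp add: spectral_value_def)
next
  case False
  then show ?thesis
    by (auto simp: spectral_value_def pencil_inv_analytic_on_def invertible_det_nz)
qed

text \<open>The determinant is not identically zero because it does not vanish at 0, so it has finitely many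
zeros in the closed disc of radius \<open>\<rho>\<close>. Apart from \<open>a\<close> these all have modulus greater than that
of \<open>a\<close>, and being finitely many they keep a positive distance from it.\<close>

lemma isolated_smallest_spectral_value:
  fixes iota :: "nat \<Rightarrow> complex^'n^'n"
  assumes "invertible (iota 0)" "spectral_value iota a"
    and small: "\<And>z. spectral_value iota z \<Longrightarrow> z \<noteq> a \<Longrightarrow> cmod a < cmod z"
    and "cmod a < \<rho>" "ereal \<rho> < conv_radius iota"
  obtains \<delta> where "0 < \<delta>" "cmod a + \<delta> \<le> \<rho>"
    "\<And>z. cmod z < cmod a + \<delta> \<Longrightarrow> z \<noteq> a \<Longrightarrow> det (pencil iota z) \<noteq> 0"
proof -
  let ?d = "\<lambda>z. det (pencil iota z)" and ?B = "eball 0 (conv_radius iota)"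
  have "0 < conv_radius iota"
    using assms(4,5) by (smt (verit) ereal_less_le norm_ge_zero order_less_le_trans zero_ereal_def ereal_less(2))
  have "?d 0 \<noteq> 0"
    using assms(1) by (simp add: pencil_0 invertible_det_nz)
  moreover have "?d a = 0" "a \<in> ?B"
    using assms(2) by (auto simp: spectral_value_iff_det)
  moreover have "0 \<in> ?B"
    using \<open>0 < conv_radius iota\<close> by (simp add: zero_ereal_def)
  ultimately have nonconst: "\<not> ?d constant_on ?B"
    unfolding constant_on_def by metis
  have "cball 0 \<rho> \<subseteq> ?B"
    using assms(5) by (auto simp: le_less_trans[of _ "ereal \<rho>"])
  then have "finite {z \<in> cball 0 \<rho>. ?d z = 0}"
    using nonconst by (intro holomorphic_compact_finite_zeros[of _ ?B])
      (auto intro!: det_holomorphic pencil_entry_holomorphic)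
  define Z where "Z = {z \<in> cball 0 \<rho>. ?d z = 0} - {a}"
  define \<delta> where "\<delta> = Min (insert (\<rho> - cmod a) ((\<lambda>z. cmod z - cmod a) ` Z))"
  have fin: "finite (insert (\<rho> - cmod a) ((\<lambda>z. cmod z - cmod a) ` Z))"
    using \<open>finite {z \<in> cball 0 \<rho>. ?d z = 0}\<close> by (auto simp: Z_def)
  have "cmod a < cmod z" if "z \<in> Z" for z
    using that le_less_trans[OF _ assms(5), of "ereal (cmod z)"]
    by (intro small) (auto simp: Z_def spectral_value_iff_det)
  then have "0 < \<delta>"
    using fin assms(4) by (auto simp: \<delta>_def)
  moreover have "\<delta> \<le> \<rho> - cmod a" and le: "\<And>z. z \<in> Z \<Longrightarrow> \<delta> \<le> cmod z - cmod a"
    using fin by (auto simp: \<delta>_def)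
  moreover have "?d z \<noteq> 0" if "cmod z < cmod a + \<delta>" "z \<noteq> a" for z
    using le[of z] that \<open>\<delta> \<le> \<rho> - cmod a\<close> by (auto simp: Z_def)
  ultimately show ?thesis
    using that[of \<delta>] by auto
qed

text \<open>The matrix function \<open>G\<close> is the analytic continuation of \<open>(z - a)^m\<close> times the inverse of the pencil to
all of \<open>S\<close>. Multiplying by the pencil expresses this by two identities that make sense at \<open>a\<close> too,
where the inverse does not exist. If \<open>m\<close> is the pole order, then \<open>G a\<close> is the leading Laurent
coefficient.\<close>

definition clears_pole ::
    "(nat \<Rightarrow> complex^'n^'n) \<Rightarrow> complex set \<Rightarrow> complex \<Rightarrow> nat \<Rightarrow> (complex \<Rightarrow> complex^'n^'n) \<Rightarrow> bool" where
  "clears_pole iota S a m G \<longleftrightarrow> (\<forall>i j. (\<lambda>z. G z $ i $ j) holomorphic_on S) \<and>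
     (\<forall>z\<in>S. G z ** pencil iota z = mat ((z - a) ^ m) \<and> pencil iota z ** G z = mat ((z - a) ^ m))"

lemma eq_at_removed_point:
  fixes f g :: "complex \<Rightarrow> complex"
  assumes "f holomorphic_on S" "g holomorphic_on S" "open S" "a \<in> S"
    and eq: "\<And>z. z \<in> S - {a} \<Longrightarrow> f z = g z"
  shows "f a = g a"
proof -
  have "f \<midarrow>a\<rightarrow> f a" "g \<midarrow>a\<rightarrow> g a"
    using assms(1-4) by (auto simp: isCont_def[symmetric]
        dest!: holomorphic_on_imp_continuous_on simp: continuous_on_eq_continuous_at)
  moreover have "eventually (\<lambda>z. f z = g z) (at a)"
    using eventually_at_in_open[OF assms(3,4)] by eventually_elim (use eq in auto)
  ultimately show ?thesis
    using tendsto_cong LIM_unique by metis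
qed

lemma matrix_mul_entries_holomorphic:
  fixes M N :: "complex \<Rightarrow> complex^'n^'n"
  assumes "\<And>i j. (\<lambda>z. M z $ i $ j) holomorphic_on S" "\<And>i j. (\<lambda>z. N z $ i $ j) holomorphic_on S"
  shows "(\<lambda>z. (M z ** N z) $ i $ j) holomorphic_on S"
  unfolding matrix_matrix_mult_def by (simp, intro holomorphic_intros assms)

lemma mat_entries_holomorphic: "(\<lambda>z. mat ((z - a) ^ m) $ i $ j :: complex) holomorphic_on S"
  unfolding mat_def by (cases "i = j") (auto intro!: holomorphic_intros)

text \<open>Both identities are between analytic functions and so pass to the limit at \<open>a\<close>.\<close>

lemma clears_poleI:
  assumes "open S" "a \<in> S" "S \<subseteq> eball 0 (conv_radius iota)"
    and hol: "\<And>i j. (\<lambda>z. G z $ i $ j) holomorphic_on S"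
    and eq: "\<And>z. z \<in> S - {a} \<Longrightarrow> G z ** pencil iota z = mat ((z - a) ^ m)"
      "\<And>z. z \<in> S - {a} \<Longrightarrow> pencil iota z ** G z = mat ((z - a) ^ m)"
  shows "clears_pole iota S a m G"
proof -
  note hols = matrix_mul_entries_holomorphic hol pencil_entry_holomorphic[OF assms(3)]
    mat_entries_holomorphic
  have "(G a ** pencil iota a) $ i $ j = mat ((a - a) ^ m) $ i $ j"
    "(pencil iota a ** G a) $ i $ j = mat ((a - a) ^ m) $ i $ j" for i j
    using eq_at_removed_point[OF hols(1)[OF hols(2,3)] hols(4)[where a=a and m=m] assms(1,2), of i j i j]
      eq_at_removed_point[OF hols(1)[OF hols(3,2)] hols(4)[where a=a and m=m] assms(1,2), of i j i j] eq
    by simp_all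
  then have "G a ** pencil iota a = mat ((a - a) ^ m)" "pencil iota a ** G a = mat ((a - a) ^ m)"
    by (simp_all add: vec_eq_iff)
  then have "\<forall>z\<in>S. G z ** pencil iota z = mat ((z - a) ^ m) \<and> pencil iota z ** G z = mat ((z - a) ^ m)"
    using eq by (metis Diff_iff singletonD)
  then show ?thesis
    using hol by (simp add: clears_pole_def)
qed

lemma mat_mult_entry: "(\<chi> i j. c * A $ i $ j) ** B = (\<chi> i j. c * (A ** B) $ i $ j)"
  "B ** (\<chi> i j. c * A $ i $ j) = (\<chi> i j. c * (B ** A) $ i $ j)"
  for A B :: "complex^'n^'n"
  by (simp_all add: matrix_matrix_mult_def vec_eq_iff sum_distrib_left mult_ac)

text \<open>Near \<open>a\<close> the determinant is \<open>(z - a)^n\<close> times a zero-free analytic function, so \<open>(z - a)^n\<close> times the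
inverse is bounded there and its singularity is removable.\<close>

lemma clears_pole_exists:
  fixes iota :: "nat \<Rightarrow> complex^'n^'n"
  assumes "open S" "connected S" "a \<in> S" "S \<subseteq> eball 0 (conv_radius iota)"
    and det: "det (pencil iota a) = 0" "\<And>z. z \<in> S - {a} \<Longrightarrow> det (pencil iota z) \<noteq> 0"
  shows "\<exists>m G. clears_pole iota S a m G"
proof -
  let ?d = "\<lambda>z. det (pencil iota z)"
  note hp = pencil_entry_holomorphic[OF assms(4)]
  have hd: "?d holomorphic_on S"
    by (intro det_holomorphic hp)
  have nonconst: "\<not> ?d constant_on S"
  proof
    assume "?d constant_on S"
    then have "\<forall>z\<in>S. ?d z = 0"
      using det(1) assms(3) by (auto simp: constant_on_def)
    then have "S = {a}"
      using det(2) assms(3) by auto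
    then show False
      using assms(1) by (simp add: not_open_singleton)
  qed
  obtain g r n where g: "0 < r" "ball a r \<subseteq> S" "g holomorphic_on ball a r"
      "\<And>w. w \<in> ball a r \<Longrightarrow> ?d w = (w - a) ^ n * g w" "\<And>w. w \<in> ball a r \<Longrightarrow> g w \<noteq> 0"
    using holomorphic_factor_zero_nonconstant[OF hd assms(1-3) det(1) nonconst] by metis
  let ?I = "\<lambda>z. matrix_inv (pencil iota z)"
  have "\<exists>h. h holomorphic_on S \<and> (\<forall>z\<in>S - {a}. h z = (z - a) ^ n * ?I z $ i $ j)" for i j
  proof -
    let ?A = "\<lambda>z. adjugate (pencil iota z) $ i $ j"
    have hA: "?A holomorphic_on S"
      by (intro adjugate_holomorphic hp)
    have "(\<lambda>z. (z - a) ^ n * (?A z / ?d z)) holomorphic_on S - {a}"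
      using det(2) by (intro holomorphic_intros holomorphic_on_subset[OF hA] holomorphic_on_subset[OF hd]) auto
    then have hol: "(\<lambda>z. (z - a) ^ n * ?I z $ i $ j) holomorphic_on S - {a}"
      by (rule holomorphic_transform) (use det(2) in \<open>simp add: matrix_inv_adjugate\<close>)
    have "(\<lambda>z. ?A z / g z) holomorphic_on ball a r"
      using g by (intro holomorphic_intros holomorphic_on_subset[OF hA]) auto
    then have "isCont (\<lambda>z. ?A z / g z) a"
      using g(1) by (auto dest!: holomorphic_on_imp_continuous_on simp: continuous_on_eq_continuous_at)
    then have "(\<lambda>z. norm (?A z / g z)) \<midarrow>a\<rightarrow> norm (?A a / g a)"
      unfolding isCont_def by (rule tendsto_norm)
    then have "eventually (\<lambda>z. norm (?A z / g z) < norm (?A a / g a) + 1) (at a)"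
      by (rule order_tendstoD) simp
    moreover have "eventually (\<lambda>z. z \<in> ball a r - {a}) (at a)"
      using g(1) by (intro eventually_at_in_open) auto
    ultimately have "eventually (\<lambda>z. norm ((z - a) ^ n * ?I z $ i $ j) \<le> norm (?A a / g a) + 1) (at a)"
    proof eventually_elim
      case (elim z)
      then have "?d z = (z - a) ^ n * g z" "g z \<noteq> 0" "z \<noteq> a"
        using g by auto
      then have "(z - a) ^ n * ?I z $ i $ j = ?A z / g z"
        by (subst matrix_inv_adjugate) auto
      then show ?case
        using elim by simp
    qed
    then show ?thesis
      using holomorphic_on_extend_bounded[OF hol] assms(1,3) by (simp add: interior_open) blast
  qed
  then obtain h where h: "\<And>i j. h i j holomorphic_on S"
      "\<And>i j z. z \<in> S - {a} \<Longrightarrow> h i j z = (z - a) ^ n * ?I z $ i $ j"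
    by metis
  define G where "G z = (\<chi> i j. h i j z)" for z
  have Geq: "G z = (\<chi> i j. (z - a) ^ n * ?I z $ i $ j)" if "z \<in> S - {a}" for z
    using h(2)[OF that] by (simp add: G_def)
  have "clears_pole iota S a n G"
  proof (rule clears_poleI[OF assms(1,3,4)])
    show "(\<lambda>z. G z $ i $ j) holomorphic_on S" for i j
      using h(1) by (simp add: G_def)
    show "G z ** pencil iota z = mat ((z - a) ^ n)" "pencil iota z ** G z = mat ((z - a) ^ n)"
      if "z \<in> S - {a}" for z
      using det(2)[OF that]
      by (simp_all add: Geq[OF that] mat_mult_entry matrix_inv_props invertible_det_nz)
        (simp_all add: mat_def vec_eq_iff)
  qed
  then show ?thesis
    by blast
qed

lemma clears_pole_lower:
  fixes iota :: "nat \<Rightarrow> complex^'n^'n"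
  assumes "open S" "a \<in> S" "S \<subseteq> eball 0 (conv_radius iota)"
    and "clears_pole iota S a (Suc m) G" "G a = 0"
  shows "\<exists>G'. clears_pole iota S a m G'"
proof -
  define G' where "G' z = (\<chi> i j. if z = a then deriv (\<lambda>z. G z $ i $ j) a else G z $ i $ j / (z - a))" for z
  have G'_eq: "G' z = (\<chi> i j. inverse (z - a) * G z $ i $ j)" if "z \<noteq> a" for z
    using that by (simp add: G'_def vec_eq_iff divide_inverse mult.commute)
  have "clears_pole iota S a m G'"
  proof (rule clears_poleI[OF assms(1-3)])
    show "(\<lambda>z. G' z $ i $ j) holomorphic_on S" for i j
      by (rule pole_theorem_open_0[of "\<lambda>z. G z $ i $ j" S a])
        (use assms in \<open>auto simp: clears_pole_def G'_def\<close>)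
    show "G' z ** pencil iota z = mat ((z - a) ^ m)" "pencil iota z ** G' z = mat ((z - a) ^ m)"
      if "z \<in> S - {a}" for z
      using that assms(4) by (simp_all add: clears_pole_def G'_eq mat_mult_entry)
        (simp_all add: mat_def vec_eq_iff)
  qed
  then show ?thesis
    by blast
qed

text \<open>The least possible exponent is the order of the pole. It is positive because exponent 0 would make the
pencil invertible at \<open>a\<close>, and \<open>G a\<close> is nonzero because a zero could be divided out, lowering the
exponent.\<close>

lemma pole_of_inverse:
  fixes iota :: "nat \<Rightarrow> complex^'n^'n"
  assumes "open S" "connected S" "a \<in> S" "S \<subseteq> eball 0 (conv_radius iota)"
    and det: "det (pencil iota a) = 0" "\<And>z. z \<in> S - {a} \<Longrightarrow> det (pencil iota z) \<noteq> 0"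
  obtains m G where "0 < m" "clears_pole iota S a m G" "G a \<noteq> 0"
proof -
  define m where "m = (LEAST m. \<exists>G. clears_pole iota S a m G)"
  have "\<exists>G. clears_pole iota S a m G"
    unfolding m_def by (rule LeastI_ex) (rule clears_pole_exists[OF assms])
  then obtain G where G: "clears_pole iota S a m G"
    by blast
  have "m \<noteq> 0"
  proof
    assume "m = 0"
    then have "G a ** pencil iota a = mat 1"
      using G assms(3) by (auto simp: clears_pole_def)
    then have "invertible (pencil iota a)"
      unfolding invertible_left_inverse by blast
    then show False
      using det(1) by (simp add: invertible_det_nz)
  qed
  moreover have "G a \<noteq> 0"
  proof
    assume "G a = 0"
    obtain k where k: "m = Suc k"
      using \<open>m \<noteq> 0\<close> not0_implies_Suc by blast
    then have "\<exists>G'. clears_pole iota S a k G'"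
      using clears_pole_lower[of S a iota k G] assms(1,3,4) \<open>G a = 0\<close> G by blast
    then have "m \<le> k"
      unfolding m_def by (rule Least_le)
    then show False
      using k by simp
  qed
  ultimately show ?thesis
    using that G by blast
qed

section \<open>Coefficient asymptotics at a pole\<close>

text \<open>The coefficients of \<open>(1 - z)^(-m)\<close>, which for \<open>m > 0\<close> grow like \<open>k^(m - 1)\<close>.\<close>

definition neg_binom :: "nat \<Rightarrow> nat \<Rightarrow> real" where
  "neg_binom m k = real ((m + k - 1) choose k)"

lemma neg_binom_ge_1:
  assumes "0 < m"
  shows "1 \<le> neg_binom m k"
proof -
  have "0 < (m + k - 1) choose k"
    using assms by (simp add: zero_less_binomial_iff)
  then show ?thesis
    unfolding neg_binom_def real_of_nat_ge_one_iff by linarith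
qed

lemma neg_binom_Suc:
  assumes "0 < m"
  shows "neg_binom m (Suc k) = real (m + k) / real (Suc k) * neg_binom m k"
proof -
  obtain n where m: "m = Suc n"
    using assms not0_implies_Suc by blast
  have "Suc k * (Suc (n + k) choose Suc k) = Suc (n + k) * (n + k choose k)"
    by (rule Suc_times_binomial)
  then have "real (Suc k) * real (Suc (n + k) choose Suc k) = real (Suc (n + k)) * real (n + k choose k)"
    by (simp only: of_nat_mult[symmetric])
  then show ?thesis
    by (simp add: neg_binom_def m field_simps)
qed

lemma neg_binom_mono:
  assumes "0 < m" "i \<le> k"
  shows "neg_binom m i \<le> neg_binom m k"
proof (rule lift_Suc_mono_le[OF _ assms(2)])
  fix k
  have "1 * neg_binom m k \<le> real (m + k) / real (Suc k) * neg_binom m k"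
    using assms(1) neg_binom_ge_1[OF assms(1), of k] by (intro mult_right_mono) auto
  then show "neg_binom m k \<le> neg_binom m (Suc k)"
    using assms(1) by (simp add: neg_binom_Suc)
qed

lemma neg_binom_ratio_tendsto_1:
  assumes "0 < m"
  shows "(\<lambda>k. neg_binom m (k - i) / neg_binom m k) \<longlonglongrightarrow> 1"
proof -
  have pos: "0 < neg_binom m k" for k
    using neg_binom_ge_1[OF assms, of k] by linarith
  have "(\<lambda>k. real (Suc k) / real (m + k)) \<longlonglongrightarrow> 1"
    by real_asymp
  moreover have "real (Suc k) / real (m + k) = neg_binom m k / neg_binom m (Suc k)" for k
    using pos[of k] assms by (simp add: neg_binom_Suc)
  ultimately have step: "(\<lambda>k. neg_binom m k / neg_binom m (Suc k)) \<longlonglongrightarrow> 1"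
    by simp
  have "(\<lambda>k. neg_binom m k / neg_binom m (k + i)) \<longlonglongrightarrow> 1"
  proof (induction i)
    case 0
    then show ?case
      using pos[THEN less_imp_neq, THEN not_sym] by simp
  next
    case (Suc i)
    have lim: "(\<lambda>k. neg_binom m k / neg_binom m (k + i) * (neg_binom m (k + i) / neg_binom m (Suc (k + i)))) \<longlonglongrightarrow> 1 * 1"
      by (intro tendsto_mult Suc LIMSEQ_ignore_initial_segment[OF step])
    have "neg_binom m k / neg_binom m (k + i) * (neg_binom m (k + i) / neg_binom m (Suc (k + i)))
        = neg_binom m k / neg_binom m (k + Suc i)" for k
      using pos[of "k + i"] by simp
    then show ?case
      using lim by (simp only: mult_1)
  qed
  then have "(\<lambda>k. neg_binom m (k + i - i) / neg_binom m (k + i)) \<longlonglongrightarrow> 1"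
    by simp
  then show ?thesis
    by (rule LIMSEQ_offset)
qed

text \<open>Dividing by \<open>(X - a)^m\<close> convolves the coefficients \<open>h i\<close> of \<open>H\<close>, rescaled by \<open>a^i\<close>, with
\<open>neg_binom m\<close>. After division by \<open>neg_binom m k\<close> the weights in this convolution are at most 1 and
tend to 1. Since the rescaled coefficients of \<open>H\<close> are absolutely summable, Tannery's theorem gives
their full sum in the limit, which is the value of \<open>H\<close> at \<open>a\<close>.\<close>

lemma pole_coefficient_asymptotics:
  fixes Y H :: "complex fps"
  assumes "a \<noteq> 0" "0 < m" and eq: "(fps_X - fps_const a) ^ m * Y = H"
    and conv: "ereal (cmod a) < fps_conv_radius H"
  shows "(\<lambda>k. a ^ k / of_real (neg_binom m k) * fps_nth Y k) \<longlonglongrightarrow> eval_fps H a / (- a) ^ m"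
proof -
  let ?b = "neg_binom m"
  have pos: "0 < ?b k" for k
    using neg_binom_ge_1[OF assms(2), of k] by linarith
  let ?P = "(1 - fps_const (1 / a) * fps_X) ^ m"
  have factor: "fps_X - fps_const a = fps_const (- a) * (1 - fps_const (1 / a) * fps_X)"
    using assms(1) by (simp add: fps_eq_iff fps_X_def)
  have "H = fps_const ((- a) ^ m) * ?P * Y"
    unfolding eq[symmetric] factor power_mult_distrib fps_const_power ..
  then have "inverse ?P * H = fps_const ((- a) ^ m) * (inverse ?P * ?P) * Y"
    by (simp only: mult_ac)
  also have "inverse ?P * ?P = 1"
    by (rule inverse_mult_eq_1) simp
  finally have Y: "inverse ?P * H = fps_const ((- a) ^ m) * Y"
    by (simp only: mult_1_right)
  have inv: "inverse ?P = Abs_fps (\<lambda>k. of_real (?b k) * (1 / a) ^ k)"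
    by (simp add: one_minus_const_fps_X_neg_power'[OF assms(2)] neg_binom_def)
  define h where "h i = fps_nth H i * a ^ i" for i
  have conv_sum: "a ^ k / of_real (?b k) * fps_nth Y k * (- a) ^ m
      = (\<Sum>i. if i \<le> k then h i * of_real (?b (k - i) / ?b k) else 0)" for k
  proof -
    have "(- a) ^ m * fps_nth Y k = fps_nth (H * inverse ?P) k"
      by (simp add: Y mult.commute[of H])
    also have "\<dots> = (\<Sum>i\<le>k. fps_nth H i * (of_real (?b (k - i)) * (1 / a) ^ (k - i)))"
      by (simp add: inv fps_mult_nth atLeast0AtMost)
    finally have "a ^ k / of_real (?b k) * ((- a) ^ m * fps_nth Y k)
        = (\<Sum>i\<le>k. a ^ k / of_real (?b k) * (fps_nth H i * (of_real (?b (k - i)) * (1 / a) ^ (k - i))))"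
      by (simp only: sum_distrib_left)
    also have "\<dots> = (\<Sum>i\<le>k. h i * of_real (?b (k - i) / ?b k))"
    proof (rule sum.cong)
      fix i assume "i \<in> {..k}"
      then have "a ^ k = a ^ i * a ^ (k - i)"
        by (simp flip: power_add)
      then show "a ^ k / of_real (?b k) * (fps_nth H i * (of_real (?b (k - i)) * (1 / a) ^ (k - i)))
          = h i * of_real (?b (k - i) / ?b k)"
        using assms(1) by (simp add: h_def power_divide)
    qed simp
    also have "\<dots> = (\<Sum>i. if i \<le> k then h i * of_real (?b (k - i) / ?b k) else 0)"
      by (subst suminf_finite[of "{..k}"]) auto
    finally show ?thesis
      by (simp only: mult_ac)
  qed
  have "(\<lambda>k. \<Sum>i. if i \<le> k then h i * of_real (?b (k - i) / ?b k) else 0) \<longlonglongrightarrow> (\<Sum>i. h i)"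
  proof (rule conjunct2[OF conjunct2[OF tannerys_theorem[where M="\<lambda>i. norm (h i)"]]])
    fix i
    have "(\<lambda>k. h i * of_real (?b (k - i) / ?b k)) \<longlonglongrightarrow> h i * of_real 1"
      by (intro tendsto_intros neg_binom_ratio_tendsto_1 assms(2))
    moreover have "eventually (\<lambda>k. h i * of_real (?b (k - i) / ?b k)
        = (if i \<le> k then h i * of_real (?b (k - i) / ?b k) else 0)) sequentially"
      using eventually_ge_at_top[of i] by eventually_elim simp
    ultimately show "(\<lambda>k. if i \<le> k then h i * of_real (?b (k - i) / ?b k) else 0) \<longlonglongrightarrow> h i"
      unfolding of_real_1 mult_1_right by (rule Lim_transform_eventually)
  next
    have "norm (h i * of_real (?b (k - i) / ?b k)) \<le> norm (h i)" for i k
    proof -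
      have "\<bar>?b (k - i) / ?b k\<bar> \<le> 1"
        using neg_binom_mono[OF assms(2), of "k - i" k] pos[of k] pos[of "k - i"] by simp
      then have "norm (h i) * \<bar>?b (k - i) / ?b k\<bar> \<le> norm (h i) * 1"
        by (intro mult_left_mono) auto
      then show ?thesis
        by (simp only: norm_mult norm_of_real mult_1_right)
    qed
    then show "eventually (\<lambda>(i, k). norm (if i \<le> k then h i * of_real (?b (k - i) / ?b k) else 0) \<le> norm (h i))
        (at_top \<times>\<^sub>F at_top)"
      by (intro always_eventually) auto
  next
    show "summable (\<lambda>i. norm (h i))"
      unfolding h_def using conv by (rule norm_summable_fps)
  qed simp
  then have "(\<lambda>k. a ^ k / of_real (?b k) * fps_nth Y k * (- a) ^ m) \<longlonglongrightarrow> eval_fps H a"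
    by (simp only: conv_sum h_def eval_fps_def)
  then have "(\<lambda>k. a ^ k / of_real (?b k) * fps_nth Y k * (- a) ^ m / (- a) ^ m) \<longlonglongrightarrow> eval_fps H a / (- a) ^ m"
    using assms(1) by (intro tendsto_divide) auto
  then show ?thesis
    using assms(1) by simp
qed

lemma fps_sum_conv_eval:
  fixes f :: "'i \<Rightarrow> complex fps"
  assumes "finite I" "\<And>i. i \<in> I \<Longrightarrow> r \<le> fps_conv_radius (f i)"
  shows "r \<le> fps_conv_radius (sum f I)"
    and "ereal (cmod z) < r \<Longrightarrow> eval_fps (sum f I) z = (\<Sum>i\<in>I. eval_fps (f i) z)"
proof -
  have "r \<le> fps_conv_radius (sum f I) \<and>
      (ereal (cmod z) < r \<longrightarrow> eval_fps (sum f I) z = (\<Sum>i\<in>I. eval_fps (f i) z))"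
    using assms
  proof (induction I rule: finite_induct)
    case (insert i I)
    have "r \<le> fps_conv_radius (f i + sum f I)"
      using insert by (intro fps_conv_radius_add_ge) auto
    moreover have "eval_fps (f i + sum f I) z = eval_fps (f i) z + eval_fps (sum f I) z"
      if "ereal (cmod z) < r"
      using insert that by (intro eval_fps_add) (auto simp: less_le_trans)
    ultimately show ?case
      using insert by simp
  qed simp
  then show "r \<le> fps_conv_radius (sum f I)"
    "ereal (cmod z) < r \<Longrightarrow> eval_fps (sum f I) z = (\<Sum>i\<in>I. eval_fps (f i) z)"
    by auto
qed

section \<open>The companion operator on weighted sequence spaces\<close>

text \<open>The crude constant comes from estimating entry by entry; only boundedness matters in the sequel.\<close>

lemma norm_matrix_vector_le:
  fixes A :: "complex^'n^'n"
  shows "norm (A *v x) \<le> (real CARD('n))\<^sup>2 * (norm A * norm x)"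
proof -
  have "norm ((A *v x) $ i) \<le> real CARD('n) * (norm A * norm x)" for i
  proof -
    have "norm ((A *v x) $ i) \<le> (\<Sum>j\<in>UNIV. norm (A $ i $ j * x $ j))"
      unfolding matrix_vector_mult_def by (simp add: norm_sum)
    also have "\<dots> \<le> (\<Sum>j\<in>(UNIV :: 'n set). norm A * norm x)"
      by (intro sum_mono) (simp add: norm_mult mult_mono norm_entry_le Finite_Cartesian_Product.norm_nth_le)
    finally show ?thesis
      by simp
  qed
  then have "(\<Sum>i\<in>UNIV. norm ((A *v x) $ i)) \<le> (\<Sum>i\<in>(UNIV :: 'n set). real CARD('n) * (norm A * norm x))"
    by (intro sum_mono)
  moreover have "norm (A *v x) \<le> (\<Sum>i\<in>UNIV. norm ((A *v x) $ i))"
    unfolding norm_vec_def by (rule L2_set_le_sum) simp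
  ultimately show ?thesis
    by (simp add: power2_eq_square mult_ac)
qed

lemma matrix_vector_mult_neg:
  fixes A :: "complex^'n^'n"
  shows "A *v (- x) = - (A *v x)"
  by (simp add: vec_eq_iff matrix_vector_mult_def sum_negf)

lemma bounded_linear_vector_scalar:
  "bounded_linear (\<lambda>x :: complex^'n. c *s x)"
proof (rule bounded_linear_intro)
  show "norm (c *s x) \<le> norm x * norm c" for x :: "complex^'n"
    by (simp add: norm_vector_scalar_mult)
qed (auto simp: vec_eq_iff distrib_left)

text \<open>The entries of \<open>u\<close> grow at most like \<open>\<rho>^j\<close> while the series of \<open>norm (iota j) * \<rho>^j\<close> converges because
\<open>\<rho>\<close> is smaller than the radius of convergence. The factor \<open>\<rho>^k\<close> on the left makes the bound uniform
in \<open>k\<close>, which later gives a radius of convergence of at least \<open>\<rho>\<close> for the forcing series.\<close>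

lemma pairing_bound:
  fixes iota :: "nat \<Rightarrow> complex^'n^'n"
  assumes "0 < \<rho>" "1 \<le> p" "ereal \<rho> < conv_radius iota" "u \<in> lp_space p \<rho>"
  shows "summable (\<lambda>j. iota (k + j) *v u (Suc j))"
    and "norm (\<Sum>j. iota (k + j) *v u (Suc j)) * \<rho> ^ k
      \<le> (real CARD('n))\<^sup>2 * (lp_norm p \<rho> u * \<rho>) * (\<Sum>j. norm (iota j) * \<rho> ^ j)"
proof -
  let ?C = "(real CARD('n))\<^sup>2 * (lp_norm p \<rho> u * \<rho>)"
  have C: "0 \<le> ?C"
    using assms(1) lp_norm_nonneg[OF assms(1,4)] by simp
  have summ: "summable (\<lambda>j. norm (iota j) * \<rho> ^ j)"
    using assms(1,3) by (intro summable_norm_coeffs) auto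
  have summ_k: "summable (\<lambda>j. norm (iota (k + j)) * \<rho> ^ (k + j))"
    using summable_ignore_initial_segment[OF summ, of k] by (simp add: add.commute)
  have bound: "norm (iota (k + j) *v u (Suc j)) * \<rho> ^ k \<le> ?C * (norm (iota (k + j)) * \<rho> ^ (k + j))" for j
  proof -
    have "norm (iota (k + j) *v u (Suc j)) \<le> (real CARD('n))\<^sup>2 * (norm (iota (k + j)) * (lp_norm p \<rho> u * \<rho> ^ Suc j))"
      using norm_le_lp_norm[OF assms(1,2,4), of "Suc j"]
      by (intro order.trans[OF norm_matrix_vector_le] mult_left_mono) auto
    then have "norm (iota (k + j) *v u (Suc j)) * \<rho> ^ k
        \<le> (real CARD('n))\<^sup>2 * (norm (iota (k + j)) * (lp_norm p \<rho> u * \<rho> ^ Suc j)) * \<rho> ^ k"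
      using assms(1) by (intro mult_right_mono) auto
    then show ?thesis
      by (simp add: power_add mult_ac)
  qed
  have "summable (\<lambda>j. norm (iota (k + j) *v u (Suc j)) * \<rho> ^ k)"
    using bound assms(1) by (intro summable_comparison_test'[OF summable_mult[OF summ_k, of ?C]]) auto
  then have "summable (\<lambda>j. norm (iota (k + j) *v u (Suc j)) * \<rho> ^ k * inverse (\<rho> ^ k))"
    by (rule summable_mult2)
  moreover have "\<rho> ^ k * inverse (\<rho> ^ k) = 1"
    using assms(1) by simp
  ultimately have summ_norm: "summable (\<lambda>j. norm (iota (k + j) *v u (Suc j)))"
    by (simp only: mult.assoc mult_1_right)
  then show "summable (\<lambda>j. iota (k + j) *v u (Suc j))"
    by (rule summable_norm_cancel)
  have "norm (\<Sum>j. iota (k + j) *v u (Suc j)) * \<rho> ^ k \<le> (\<Sum>j. norm (iota (k + j) *v u (Suc j))) * \<rho> ^ k"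
    using assms(1) by (intro mult_right_mono summable_norm summ_norm) auto
  also have "\<dots> = (\<Sum>j. norm (iota (k + j) *v u (Suc j)) * \<rho> ^ k)"
    by (rule suminf_mult2[OF summ_norm])
  also have "\<dots> \<le> (\<Sum>j. ?C * (norm (iota (k + j)) * \<rho> ^ (k + j)))"
    by (intro suminf_le bound summable_mult summ_k summable_mult2 summ_norm)
  also have "\<dots> = ?C * (\<Sum>j. norm (iota (k + j)) * \<rho> ^ (k + j))"
    by (rule suminf_mult[OF summ_k])
  also have "\<dots> \<le> ?C * (\<Sum>j. norm (iota j) * \<rho> ^ j)"
  proof (rule mult_left_mono[OF _ C])
    have "(\<Sum>j. norm (iota j) * \<rho> ^ j) = (\<Sum>j. norm (iota (k + j)) * \<rho> ^ (k + j)) + (\<Sum>j<k. norm (iota j) * \<rho> ^ j)"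
      using suminf_split_initial_segment[OF summ, of k] by (simp add: add.commute)
    moreover have "0 \<le> (\<Sum>j<k. norm (iota j) * \<rho> ^ j)"
      using assms(1) by (intro sum_nonneg) auto
    ultimately show "(\<Sum>j. norm (iota (k + j)) * \<rho> ^ (k + j)) \<le> (\<Sum>j. norm (iota j) * \<rho> ^ j)"
      by linarith
  qed
  finally show "norm (\<Sum>j. iota (k + j) *v u (Suc j)) * \<rho> ^ k \<le> ?C * (\<Sum>j. norm (iota j) * \<rho> ^ j)" .
qed

lemma companion_summable:
  fixes iota :: "nat \<Rightarrow> complex^'n^'n"
  assumes "0 < \<rho>" "1 \<le> p" "ereal \<rho> < conv_radius iota" "u \<in> lp_space p \<rho>"
  shows "summable (\<lambda>k. iota (Suc k) *v u (Suc k))"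
  using pairing_bound(1)[OF assms, of 1] by simp

lemma lp_single:
  assumes "0 < \<rho>" "1 \<le> p"
  shows "(\<lambda>j. if j = 1 then v else 0) \<in> lp_space p \<rho>"
proof (rule lp_norm_le_l1[OF assms])
  show "summable (\<lambda>j. norm (if j = 1 then v else 0) / \<rho> ^ j)"
    by (rule summable_finite[of "{1}"]) auto
qed simp

lemma companion_op_in_lp:
  fixes iota :: "nat \<Rightarrow> complex^'n^'n"
  assumes "0 < \<rho>" "1 \<le> p" "u \<in> lp_space p \<rho>"
  shows "companion_op iota u \<in> lp_space p \<rho>"
proof -
  have "companion_op iota u = seq_shift 1 u + (\<lambda>j. if j = 1 then companion_op iota u 1 else 0)"
    by (auto simp: fun_eq_iff companion_op_def seq_shift_def)
  then show ?thesis
    using lp_add(1)[OF assms(1,2) lp_shift(1)[OF assms] lp_single[OF assms(1,2)]] by metis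
qed

lemma companion_pow_in_lp:
  fixes iota :: "nat \<Rightarrow> complex^'n^'n"
  assumes "0 < \<rho>" "1 \<le> p" "u \<in> lp_space p \<rho>"
  shows "(companion_op iota ^^ k) u \<in> lp_space p \<rho>"
  by (induction k) (auto intro: companion_op_in_lp[OF assms(1,2)] assms(3))

lemma companion_op_add:
  fixes iota :: "nat \<Rightarrow> complex^'n^'n"
  assumes "0 < \<rho>" "1 \<le> p" "ereal \<rho> < conv_radius iota" "u \<in> lp_space p \<rho>" "v \<in> lp_space p \<rho>"
  shows "companion_op iota (u + v) = companion_op iota u + companion_op iota v"
proof
  fix j
  have "(\<Sum>k. iota (Suc k) *v (u + v) (Suc k)) = (\<Sum>k. iota (Suc k) *v u (Suc k)) + (\<Sum>k. iota (Suc k) *v v (Suc k))"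
    using suminf_add[OF companion_summable[OF assms(1-4)] companion_summable[OF assms(1-3,5)]]
    by (simp add: matrix_vector_right_distrib)
  then show "companion_op iota (u + v) j = (companion_op iota u + companion_op iota v) j"
    by (simp add: companion_op_def matrix_vector_right_distrib)
qed

lemma companion_op_scale:
  fixes iota :: "nat \<Rightarrow> complex^'n^'n"
  assumes "0 < \<rho>" "1 \<le> p" "ereal \<rho> < conv_radius iota" "u \<in> lp_space p \<rho>"
  shows "companion_op iota (seq_scale c u) = seq_scale c (companion_op iota u)"
proof
  fix j
  have "(\<Sum>k. iota (Suc k) *v seq_scale c u (Suc k)) = c *s (\<Sum>k. iota (Suc k) *v u (Suc k))"
    using bounded_linear.suminf[OF bounded_linear_vector_scalar companion_summable[OF assms], of c]
    by (simp add: seq_scale_def vector_scalar_commute)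
  then show "companion_op iota (seq_scale c u) j = seq_scale c (companion_op iota u) j"
    by (simp add: companion_op_def vector_scalar_commute vector_smult_rneg seq_scale_def)
qed

lemma companion_pow_add:
  fixes iota :: "nat \<Rightarrow> complex^'n^'n"
  assumes "0 < \<rho>" "1 \<le> p" "ereal \<rho> < conv_radius iota" "u \<in> lp_space p \<rho>" "v \<in> lp_space p \<rho>"
  shows "(companion_op iota ^^ k) (u + v) = (companion_op iota ^^ k) u + (companion_op iota ^^ k) v"
proof (induction k)
  case (Suc k)
  then show ?case
    using companion_op_add[OF assms(1-3) companion_pow_in_lp[OF assms(1,2,4)] companion_pow_in_lp[OF assms(1,2,5)]]
    by (simp only: funpow.simps o_apply)
qed simp

lemma companion_pow_scale:
  fixes iota :: "nat \<Rightarrow> complex^'n^'n"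
  assumes "0 < \<rho>" "1 \<le> p" "ereal \<rho> < conv_radius iota" "u \<in> lp_space p \<rho>"
  shows "(companion_op iota ^^ k) (seq_scale c u) = seq_scale c ((companion_op iota ^^ k) u)"
proof (induction k)
  case (Suc k)
  then show ?case
    using companion_op_scale[OF assms(1-3) companion_pow_in_lp[OF assms(1,2,4)]]
    by (simp only: funpow.simps o_apply)
qed simp

text \<open>The operator shifts every entry by one place and computes only a new first entry. Its iterates
therefore list the first entries produced so far, latest first, followed by the initial sequence.\<close>

lemma companion_pow_components:
  fixes iota :: "nat \<Rightarrow> complex^'n^'n"
  assumes "u 0 = 0"
  shows "(companion_op iota ^^ k) u j =
    (if j = 0 then 0 else if j \<le> k then (companion_op iota ^^ (Suc k - j)) u 1 else u (j - k))"
proof (induction k arbitrary: j)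
  case 0
  then show ?case
    using assms by simp
next
  case (Suc k)
  consider "j = 0" | "j = 1" | "2 \<le> j"
    by linarith
  then show ?case
  proof cases
    case 3
    then have "(companion_op iota ^^ Suc k) u j = (companion_op iota ^^ k) u (j - 1)"
      by (simp add: companion_op_def)
    also have "\<dots> = (if j - 1 = 0 then 0 else if j - 1 \<le> k
        then (companion_op iota ^^ (Suc k - (j - 1))) u 1 else u (j - 1 - k))"
      by (rule Suc)
    also have "Suc k - (j - 1) = Suc (Suc k) - j"
      using 3 by simp
    also have "j - 1 - k = j - Suc k"
      by simp
    finally show ?thesis
      using 3 by (auto simp: le_diff_conv)
  next
    case 1
    then show ?thesis
      by (simp add: companion_op_def)
  qed simp
qed

text \<open>The contribution of the initial sequence \<open>u\<close> to step \<open>k\<close> of the recurrence satisfied by the first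
entries of the iterates. The recurrence starts at step 1, whence the value 0 at \<open>k = 0\<close>.\<close>

definition forcing :: "(nat \<Rightarrow> complex^'n^'n) \<Rightarrow> (nat \<Rightarrow> complex^'n) \<Rightarrow> nat \<Rightarrow> complex^'n" where
  "forcing iota u k = (if k = 0 then 0 else \<Sum>j. iota (k + j) *v u (Suc j))"

definition forcing_fps :: "(nat \<Rightarrow> complex^'n^'n) \<Rightarrow> (nat \<Rightarrow> complex^'n) \<Rightarrow> 'n \<Rightarrow> complex fps" where
  "forcing_fps iota u i = Abs_fps (\<lambda>k. forcing iota u k $ i)"

text \<open>The constant coefficient is 0 rather than an entry of \<open>u\<close>: the initial data enter through
\<open>forcing\<close> only.\<close>

definition iterate_fps :: "(nat \<Rightarrow> complex^'n^'n) \<Rightarrow> (nat \<Rightarrow> complex^'n) \<Rightarrow> 'n \<Rightarrow> complex fps" where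
  "iterate_fps iota u i = Abs_fps (\<lambda>k. if k = 0 then 0 else (companion_op iota ^^ k) u 1 $ i)"

lemma forcing_fps_conv_radius:
  fixes iota :: "nat \<Rightarrow> complex^'n^'n"
  assumes "0 < \<rho>" "1 \<le> p" "ereal \<rho> < conv_radius iota" "u \<in> lp_space p \<rho>"
  shows "ereal \<rho> \<le> fps_conv_radius (forcing_fps iota u i)"
  unfolding fps_conv_radius_def
proof (rule conv_radius_geI_ex')
  fix r :: real
  assume r: "0 < r" "ereal r < ereal \<rho>"
  let ?C = "(real CARD('n))\<^sup>2 * (lp_norm p \<rho> u * \<rho>) * (\<Sum>j. norm (iota j) * \<rho> ^ j)"
  have "0 \<le> ?C"
    using pairing_bound(2)[OF assms, of 0] by (simp add: order.trans[OF norm_ge_zero])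
  have le: "norm (fps_nth (forcing_fps iota u i) k * complex_of_real r ^ k) \<le> ?C * (r / \<rho>) ^ k" for k
  proof -
    have "norm (forcing iota u k $ i) * \<rho> ^ k \<le> norm (forcing iota u k) * \<rho> ^ k"
      using assms(1) by (intro mult_right_mono Finite_Cartesian_Product.norm_nth_le) auto
    also have "\<dots> \<le> ?C"
      using pairing_bound(2)[OF assms, of k] \<open>0 \<le> ?C\<close> by (simp add: forcing_def)
    finally have "norm (forcing iota u k $ i) * \<rho> ^ k * (r / \<rho>) ^ k \<le> ?C * (r / \<rho>) ^ k"
      using assms(1) r by (intro mult_right_mono) auto
    then show ?thesis
      using assms(1) r by (simp add: forcing_fps_def norm_mult norm_power power_divide)
  qed
  have "summable (\<lambda>k. ?C * (r / \<rho>) ^ k)"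
    using assms(1) r by (intro summable_mult summable_geometric) auto
  then show "summable (\<lambda>k. fps_nth (forcing_fps iota u i) k * complex_of_real r ^ k)"
    using le by (rule summable_comparison_test')
qed

text \<open>Multiplying the definition of the new first entry by \<open>iota 0\<close> gives a convolution of the coefficients of the
pencil with the whole history. The part of it that involves entries of \<open>u\<close> is the forcing term.\<close>

lemma companion_recurrence:
  fixes iota :: "nat \<Rightarrow> complex^'n^'n"
  assumes "0 < \<rho>" "1 \<le> p" "ereal \<rho> < conv_radius iota" "u \<in> lp_space p \<rho>" "invertible (iota 0)" "0 < k"
  shows "(\<Sum>i<k. iota i *v (companion_op iota ^^ (k - i)) u 1) = - forcing iota u k"
proof -
  obtain n where n: "k = Suc n"
    using assms(6) not0_implies_Suc by blast
  have u0: "u 0 = 0"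
    using assms(4) by (simp add: lp_space_def)
  let ?x = "(companion_op iota ^^ n) u"
  let ?S = "\<Sum>i. iota (Suc i) *v ?x (Suc i)"
  have "iota 0 *v (companion_op iota ^^ k) u 1 = - ?S"
    using matrix_inv_props(1)[OF assms(5)]
    by (simp add: n companion_op_def matrix_vector_mult_neg matrix_vector_mul_assoc)
  moreover have "?S = (\<Sum>i. iota (Suc (i + n)) *v ?x (Suc (i + n))) + (\<Sum>i<n. iota (Suc i) *v ?x (Suc i))"
    by (rule suminf_split_initial_segment)
      (rule companion_summable[OF assms(1-3) companion_pow_in_lp[OF assms(1,2,4)]])
  moreover have "(\<Sum>i. iota (Suc (i + n)) *v ?x (Suc (i + n))) = forcing iota u k"
    by (simp add: companion_pow_components[of u, OF u0] forcing_def n add.commute)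
  moreover have "(\<Sum>i<n. iota (Suc i) *v ?x (Suc i)) = (\<Sum>i<n. iota (Suc i) *v (companion_op iota ^^ (n - i)) u 1)"
    by (intro sum.cong) (auto simp: companion_pow_components[of u, OF u0])
  ultimately show ?thesis
    by (simp only: n sum.lessThan_Suc_shift diff_Suc_Suc diff_zero) simp
qed

section \<open>Generating function of the iterates\<close>

text \<open>Coefficient \<open>k\<close> of the product is the convolution in \<open>companion_recurrence\<close>; the missing summand
\<open>i = k\<close> is multiplied by the constant coefficient 0 of the generating function.\<close>

lemma pencil_mult_iterate_fps:
  fixes iota :: "nat \<Rightarrow> complex^'n^'n"
  assumes "0 < \<rho>" "1 \<le> p" "ereal \<rho> < conv_radius iota" "u \<in> lp_space p \<rho>" "invertible (iota 0)"
  shows "(\<Sum>j\<in>UNIV. entry_fps iota i j * iterate_fps iota u j) = - forcing_fps iota u i"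
proof (rule fps_ext)
  fix k
  show "fps_nth (\<Sum>j\<in>UNIV. entry_fps iota i j * iterate_fps iota u j) k = fps_nth (- forcing_fps iota u i) k"
  proof (cases "k = 0")
    case True
    then show ?thesis
      by (simp add: fps_sum_nth iterate_fps_def forcing_fps_def forcing_def)
  next
    case False
    have "fps_nth (\<Sum>j\<in>UNIV. entry_fps iota i j * iterate_fps iota u j) k
        = (\<Sum>j\<in>UNIV. \<Sum>a\<le>k. iota a $ i $ j * fps_nth (iterate_fps iota u j) (k - a))"
      by (simp add: fps_sum_nth fps_mult_nth entry_fps_def atLeast0AtMost)
    also have "\<dots> = (\<Sum>j\<in>UNIV. \<Sum>a<k. iota a $ i $ j * (companion_op iota ^^ (k - a)) u 1 $ j)"
      by (intro sum.cong refl sum.mono_neutral_cong_right) (auto simp: iterate_fps_def)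
    also have "\<dots> = (\<Sum>a<k. iota a *v (companion_op iota ^^ (k - a)) u 1) $ i"
      by (subst sum.swap) (simp add: matrix_vector_mult_def)
    also have "\<dots> = fps_nth (- forcing_fps iota u i) k"
      using False companion_recurrence[OF assms, of k] by (simp add: forcing_fps_def)
    finally show ?thesis .
  qed
qed

definition forcing_val :: "(nat \<Rightarrow> complex^'n^'n) \<Rightarrow> (nat \<Rightarrow> complex^'n) \<Rightarrow> complex \<Rightarrow> complex^'n" where
  "forcing_val iota u z = (\<chi> i. eval_fps (forcing_fps iota u i) z)"

lemma clears_pole_fps:
  fixes iota :: "nat \<Rightarrow> complex^'n^'n"
  assumes "0 < r" "ereal r \<le> conv_radius iota" "clears_pole iota (ball 0 r) a m G"
  shows "(\<Sum>i\<in>UNIV. fps_expansion (\<lambda>z. G z $ l $ i) 0 * entry_fps iota i j)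
    = (if l = j then (fps_X - fps_const a) ^ m else 0)"
proof (rule fps_expansion_unique_complex)
  let ?f = "\<lambda>z. \<Sum>i\<in>UNIV. G z $ l $ i * eval_fps (entry_fps iota i j) z"
  have pos: "0 < fps_conv_radius (entry_fps iota i j)" for i
    using assms(1) order.trans[OF assms(2) conv_radius_le_entry_fps[of iota i j]]
    by (metis ereal_less(2) less_le_trans)
  have "(\<lambda>z. G z $ l $ i) has_fps_expansion fps_expansion (\<lambda>z. G z $ l $ i) 0" for i
    using assms by (intro has_fps_expansion_fps_expansion[of "ball 0 r"]) (auto simp: clears_pole_def)
  then show "?f has_fps_expansion (\<Sum>i\<in>UNIV. fps_expansion (\<lambda>z. G z $ l $ i) 0 * entry_fps iota i j)"
    by (intro fps_expansion_intros eval_fps_has_fps_expansion pos)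
  have "?f z = (if l = j then (z - a) ^ m else 0)" if "z \<in> ball 0 r" for z
  proof -
    have "?f z = (G z ** pencil iota z) $ l $ j"
      by (simp add: matrix_matrix_mult_def pencil_entry)
    also have "\<dots> = (mat ((z - a) ^ m) :: complex^'n^'n) $ l $ j"
      using assms(3) that by (simp add: clears_pole_def)
    finally show ?thesis
      by (simp add: mat_def)
  qed
  moreover have "eventually (\<lambda>z :: complex. z \<in> ball 0 r) (nhds 0)"
    using assms(1) by (intro eventually_nhds_in_open) auto
  ultimately have ev: "eventually (\<lambda>z. ?f z = (if l = j then (z - a) ^ m else 0)) (nhds 0)"
    by (auto elim: eventually_mono)
  have "(\<lambda>z. if l = j then (z - a) ^ m else 0) has_fps_expansion
      (if l = j then (fps_X - fps_const a) ^ m else 0)"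
    by (auto intro!: fps_expansion_intros)
  then show "?f has_fps_expansion (if l = j then (fps_X - fps_const a) ^ m else 0)"
    by (rule iffD2[OF has_fps_expansion_cong[OF ev refl]])
qed

text \<open>Multiplying the generating function identity from the left by the power series of \<open>G\<close> replaces the pencil
by the scalar \<open>(X - a)^m\<close>. What remains on the right, minus \<open>G\<close> times the forcing series, converges in a
disc that contains \<open>a\<close>, so \<open>pole_coefficient_asymptotics\<close> applies.\<close>

lemma companion_iterates_asymptotics:
  fixes iota :: "nat \<Rightarrow> complex^'n^'n"
  assumes "0 < \<rho>" "1 \<le> p" "ereal \<rho> < conv_radius iota" "u \<in> lp_space p \<rho>" "invertible (iota 0)"
    and "cmod a < r" "r \<le> \<rho>" "a \<noteq> 0" "0 < m" "clears_pole iota (ball 0 r) a m G"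
  shows "(\<lambda>k. (a ^ k / of_real (neg_binom m k)) *s (companion_op iota ^^ k) u 1)
    \<longlonglongrightarrow> (- 1 / (- a) ^ m) *s (G a *v forcing_val iota u a)"
proof (rule vec_tendstoI)
  fix l
  have r: "0 < r"
    using assms(6) norm_ge_zero[of a] by linarith
  have rR: "ereal r \<le> conv_radius iota"
    using assms(3,7) by (meson ereal_less_eq(3) less_imp_le order.trans)
  let ?g = "\<lambda>i. fps_expansion (\<lambda>z. G z $ l $ i) 0"
  have hol: "(\<lambda>z. G z $ l $ i) holomorphic_on eball 0 (ereal r)" for i
    using assms(10) by (simp add: clears_pole_def)
  define H where "H = - (\<Sum>i\<in>UNIV. ?g i * forcing_fps iota u i)"
  have "(fps_X - fps_const a) ^ m * iterate_fps iota u l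
      = (\<Sum>j\<in>UNIV. (if l = j then (fps_X - fps_const a) ^ m else 0) * iterate_fps iota u j)"
    by (simp add: if_distrib[where f="\<lambda>x. x * _"] cong: if_cong)
  also have "\<dots> = (\<Sum>j\<in>UNIV. (\<Sum>i\<in>UNIV. ?g i * entry_fps iota i j) * iterate_fps iota u j)"
    by (simp only: clears_pole_fps[OF r rR assms(10)])
  also have "\<dots> = (\<Sum>i\<in>UNIV. ?g i * (\<Sum>j\<in>UNIV. entry_fps iota i j * iterate_fps iota u j))"
    by (simp only: sum_distrib_left sum_distrib_right mult.assoc) (rule sum.swap)
  also have "\<dots> = H"
    by (simp add: pencil_mult_iterate_fps[OF assms(1-5)] H_def sum_negf)
  finally have eq: "(fps_X - fps_const a) ^ m * iterate_fps iota u l = H" .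
  have conv_g: "ereal r \<le> fps_conv_radius (?g i)" for i
    by (rule conv_radius_fps_expansion[OF hol])
  have conv_f: "ereal r \<le> fps_conv_radius (forcing_fps iota u i)" for i
    using forcing_fps_conv_radius[OF assms(1-4), of i] assms(7) by (meson ereal_less_eq(3) order.trans)
  have conv_gf: "ereal r \<le> fps_conv_radius (?g i * forcing_fps iota u i)" for i
    by (intro fps_conv_radius_mult_ge conv_g conv_f)
  have ar: "ereal (cmod a) < ereal r"
    using assms(6) by simp
  have conv_sum: "ereal r \<le> fps_conv_radius (\<Sum>i\<in>UNIV. ?g i * forcing_fps iota u i)"
    by (intro fps_sum_conv_eval(1) conv_gf) simp
  have conv_H: "ereal (cmod a) < fps_conv_radius H"
    using less_le_trans[OF ar conv_sum] by (simp add: H_def)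
  have "eval_fps H a = - (\<Sum>i\<in>UNIV. eval_fps (?g i * forcing_fps iota u i) a)"
    using fps_sum_conv_eval(2)[OF finite conv_gf ar] less_le_trans[OF ar conv_sum]
    by (simp add: H_def eval_fps_minus)
  also have "\<dots> = - (\<Sum>i\<in>UNIV. G a $ l $ i * eval_fps (forcing_fps iota u i) a)"
    using less_le_trans[OF ar conv_g] less_le_trans[OF ar conv_f] eval_fps_expansion'[OF hol ar]
    by (simp add: eval_fps_mult)
  also have "\<dots> = - (G a *v forcing_val iota u a) $ l"
    by (simp add: matrix_vector_mult_def forcing_val_def)
  finally have val: "eval_fps H a = - (G a *v forcing_val iota u a) $ l" .
  have "(\<lambda>k. a ^ k / of_real (neg_binom m k) * fps_nth (iterate_fps iota u l) k) \<longlonglongrightarrow> eval_fps H a / (- a) ^ m"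
    by (rule pole_coefficient_asymptotics[OF assms(8,9) eq conv_H])
  moreover have "eventually (\<lambda>k. a ^ k / of_real (neg_binom m k) * fps_nth (iterate_fps iota u l) k
      = ((a ^ k / of_real (neg_binom m k)) *s (companion_op iota ^^ k) u 1) $ l) sequentially"
    using eventually_gt_at_top[of 0] by eventually_elim (simp add: iterate_fps_def)
  ultimately have "(\<lambda>k. ((a ^ k / of_real (neg_binom m k)) *s (companion_op iota ^^ k) u 1) $ l)
      \<longlonglongrightarrow> eval_fps H a / (- a) ^ m"
    by (rule Lim_transform_eventually)
  then show "(\<lambda>k. ((a ^ k / of_real (neg_binom m k)) *s (companion_op iota ^^ k) u 1) $ l)
      \<longlonglongrightarrow> ((- 1 / (- a) ^ m) *s (G a *v forcing_val iota u a)) $ l"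
    by (simp add: val)
qed

text \<open>Evaluating the limit functional on sequences supported in the first entry shows later that it is not
identically zero.\<close>

lemma forcing_val_single:
  fixes iota :: "nat \<Rightarrow> complex^'n^'n"
  assumes "ereal (cmod z) < conv_radius iota"
  shows "forcing_val iota (\<lambda>j. if j = 1 then v else 0) z = (pencil iota z - iota 0) *v v"
proof -
  let ?u = "\<lambda>j. if j = 1 then v else 0"
  have "forcing iota ?u k = (if k = 0 then 0 else iota k *v v)" for k
    unfolding forcing_def by (subst suminf_finite[of "{0}"]) auto
  then have fps: "forcing_fps iota ?u i
      = (\<Sum>j\<in>UNIV. (entry_fps iota i j - fps_const (iota 0 $ i $ j)) * fps_const (v $ j))" for i
    by (auto simp: fps_eq_iff forcing_fps_def fps_sum_nth entry_fps_def matrix_vector_mult_def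
        intro!: sum.cong)
  have conv: "conv_radius iota \<le> fps_conv_radius (entry_fps iota i j - fps_const (iota 0 $ i $ j))" for i j
    by (intro fps_conv_radius_diff_ge conv_radius_le_entry_fps) auto
  have "eval_fps (forcing_fps iota ?u i) z = (\<Sum>j\<in>UNIV. (pencil iota z - iota 0) $ i $ j * v $ j)" for i
  proof -
    have "eval_fps (forcing_fps iota ?u i) z
        = (\<Sum>j\<in>UNIV. eval_fps ((entry_fps iota i j - fps_const (iota 0 $ i $ j)) * fps_const (v $ j)) z)"
      unfolding fps by (intro fps_sum_conv_eval(2)[OF _ _ assms] fps_conv_radius_mult_ge conv) auto
    also have "\<dots> = (\<Sum>j\<in>UNIV. (pencil iota z - iota 0) $ i $ j * v $ j)"
      using less_le_trans[OF assms conv] less_le_trans[OF assms conv_radius_le_entry_fps[of iota]]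
      by (simp add: eval_fps_mult eval_fps_diff pencil_entry)
    finally show ?thesis .
  qed
  then show ?thesis
    by (simp add: forcing_val_def matrix_vector_mult_def vec_eq_iff)
qed

section \<open>Convergence of the normalised iterates\<close>

text \<open>The candidate eigensequence: its shift is \<open>inverse a\<close> times itself, apart from the first entry, where
the eigenvalue equation becomes the nonlinear equation for \<open>w\<close>. The unused entry 0 is set to 0 as in
all sequences considered.\<close>

definition eigen_seq :: "complex \<Rightarrow> complex^'n \<Rightarrow> nat \<Rightarrow> complex^'n" where
  "eigen_seq a w j = (if j = 0 then 0 else a ^ (j - 1) *s w)"

lemma norm_eigen_seq_le: "norm (eigen_seq a w (Suc j)) = norm w * norm a ^ j"
  by (simp add: eigen_seq_def norm_vector_scalar_mult norm_power)

lemma eigen_seq_in_lp: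
  assumes "0 < \<rho>" "1 \<le> p" "cmod a < \<rho>"
  shows "eigen_seq a w \<in> lp_space p \<rho>"
proof (rule lp_norm_le_l1[OF assms(1,2)])
  have "summable (\<lambda>j. norm w / \<rho> * (cmod a / \<rho>) ^ j)"
    using assms by (intro summable_mult summable_geometric) auto
  then have "summable (\<lambda>j. norm (eigen_seq a w (Suc j)) / \<rho> ^ Suc j)"
    by (simp add: norm_eigen_seq_le power_divide)
  then show "summable (\<lambda>j. norm (eigen_seq a w j) / \<rho> ^ j)"
    by (subst (asm) summable_Suc_iff)
qed (simp add: eigen_seq_def)

lemma eigen_seq_eigenvector:
  fixes iota :: "nat \<Rightarrow> complex^'n^'n"
  assumes "ereal (cmod a) < conv_radius iota" "a \<noteq> 0" "invertible (iota 0)" "pencil iota a *v w = 0"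
  shows "companion_op iota (eigen_seq a w) = seq_scale (inverse a) (eigen_seq a w)"
proof
  fix j
  have entry: "(\<lambda>k. iota k $ i $ l * a ^ k) sums (pencil iota a $ i $ l)" for i l
    using sums_eval_fps[of a "entry_fps iota i l"] less_le_trans[OF assms(1) conv_radius_le_entry_fps]
    by (simp add: pencil_entry entry_fps_def)
  have "(\<lambda>k. a ^ k *s (iota k *v w)) sums (pencil iota a *v w)"
    unfolding sums_def
  proof (rule vec_tendstoI)
    fix i
    have "(\<lambda>k. \<Sum>l\<in>UNIV. iota k $ i $ l * a ^ k * w $ l) sums (\<Sum>l\<in>UNIV. pencil iota a $ i $ l * w $ l)"
      by (intro sums_sum sums_mult2 entry)
    then show "(\<lambda>n. (\<Sum>k<n. a ^ k *s (iota k *v w)) $ i) \<longlonglongrightarrow> (pencil iota a *v w) $ i"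
      by (simp add: sums_def matrix_vector_mult_def sum_distrib_left mult_ac)
  qed
  then have "(\<lambda>k. a ^ k *s (iota k *v w)) sums 0"
    using assms(4) by simp
  then have "(\<lambda>k. a ^ Suc k *s (iota (Suc k) *v w)) sums (- (iota 0 *v w))"
    using sums_Suc_iff[of "\<lambda>k. a ^ k *s (iota k *v w)" "- (iota 0 *v w)"] by simp
  then have "(\<lambda>k. inverse a *s (a ^ Suc k *s (iota (Suc k) *v w))) sums (inverse a *s (- (iota 0 *v w)))"
    by (rule bounded_linear.sums[OF bounded_linear_vector_scalar])
  moreover have "inverse a *s (a ^ Suc k *s (iota (Suc k) *v w)) = a ^ k *s (iota (Suc k) *v w)" for k
    using assms(2) by (simp add: mult.assoc[symmetric])
  ultimately have "(\<lambda>k. a ^ k *s (iota (Suc k) *v w)) sums (inverse a *s (- (iota 0 *v w)))"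
    by (simp only:)
  then have "(\<Sum>k. iota (Suc k) *v eigen_seq a w (Suc k)) = - (inverse a *s (iota 0 *v w))"
    by (simp add: sums_iff eigen_seq_def vector_scalar_commute vector_smult_rneg)
  then have "companion_op iota (eigen_seq a w) 1 = matrix_inv (iota 0) *v (iota 0 *v (inverse a *s w))"
    by (simp add: companion_op_def vector_scalar_commute matrix_vector_mult_neg)
  also have "\<dots> = inverse a *s w"
    using matrix_inv_props(2)[OF assms(3)] by (simp add: matrix_vector_mul_assoc)
  finally have one: "companion_op iota (eigen_seq a w) 1 = inverse a *s w" .
  show "companion_op iota (eigen_seq a w) j = seq_scale (inverse a) (eigen_seq a w) j"
  proof (cases "j \<le> 1")
    case True
    then show ?thesis
      using one by (cases "j = 0") (auto simp: companion_op_def seq_scale_def eigen_seq_def)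
  next
    case False
    then obtain i where "j = Suc (Suc i)"
      by (metis One_nat_def le_SucI le_add1 not0_implies_Suc plus_1_eq_Suc zero_le)
    then show ?thesis
      using assms(2) by (simp add: companion_op_def seq_scale_def eigen_seq_def)
  qed
qed

lemma tendsto_vector_scalar_mult:
  fixes f :: "'a \<Rightarrow> complex" and g :: "'a \<Rightarrow> complex^'n"
  assumes "(f \<longlongrightarrow> c) F" "(g \<longlongrightarrow> x) F"
  shows "((\<lambda>k. f k *s g k) \<longlongrightarrow> c *s x) F"
  by (rule vec_tendstoI) (use assms in \<open>auto intro!: tendsto_intros\<close>)

text \<open>The rescaled \<open>k\<close>-th iterate is split after place \<open>k\<close>. Up to there its entries are earlier rescaled first
entries, multiplied by powers of \<open>a\<close> and by ratios of \<open>neg_binom m\<close>. They converge entrywise and are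
dominated by a multiple of \<open>cmod a ^ j\<close>, which is summable against the weight since \<open>cmod a < \<rho>\<close>. The
rest is a multiple of a shifted copy of \<open>u\<close>; its norm is at most that of \<open>u\<close> times the \<open>k\<close>-th power of
\<open>cmod a / \<rho>\<close>.\<close>

lemma companion_iterates_lp_limit:
  fixes iota :: "nat \<Rightarrow> complex^'n^'n"
  assumes "0 < \<rho>" "1 \<le> p" "u \<in> lp_space p \<rho>" "a \<noteq> 0" "cmod a < \<rho>" "0 < m"
    and lim: "(\<lambda>k. (a ^ k / of_real (neg_binom m k)) *s (companion_op iota ^^ k) u 1) \<longlonglongrightarrow> w"
  shows "(\<lambda>k. lp_norm p \<rho> (seq_scale (a ^ k / of_real (neg_binom m k)) ((companion_op iota ^^ k) u)
      - eigen_seq a w)) \<longlonglongrightarrow> 0"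
proof -
  let ?b = "neg_binom m"
  define c where "c k = a ^ k / of_real (?b k)" for k
  define y where "y k = c k *s (companion_op iota ^^ k) u 1" for k
  \<comment> \<open>Entries up to place \<open>k\<close> of the rescaled iterate, minus those of the expected limit.\<close>
  define t where "t k j = (if 1 \<le> j \<and> j \<le> k then c k *s (companion_op iota ^^ (Suc k - j)) u 1 else 0)
    - eigen_seq a w j" for k j
  have u0: "u 0 = 0"
    using assms(3) by (simp add: lp_space_def)
  have b1: "1 \<le> ?b k" for k
    by (rule neg_binom_ge_1[OF assms(6)])
  have b0: "0 < ?b k" for k
    using b1[of k] by linarith
  have ylim: "y \<longlonglongrightarrow> w"
    using lim by (simp only: y_def[abs_def] c_def)
  then obtain M where M: "\<And>k. norm (y k) \<le> M"
    using convergent_imp_Bseq[of y] by (auto simp: convergent_def Bseq_def)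
  have t_eq: "t k (Suc i) = a ^ i *s (of_real (?b (k - i) / ?b k) *s y (k - i) - w)" if "i < k" for k i
  proof -
    have "a ^ k = a ^ i * a ^ (k - i)"
      using that by (simp flip: power_add)
    then have "c k = a ^ i * (of_real (?b (k - i) / ?b k) * c (k - i))"
      using b0[of "k - i"] b0[of k] by (simp add: c_def)
    moreover have "t k (Suc i) = c k *s (companion_op iota ^^ (k - i)) u 1 - a ^ i *s w"
      using that by (simp add: t_def eigen_seq_def)
    ultimately show ?thesis
      by (simp add: y_def vec_eq_iff right_diff_distrib mult.assoc)
  qed
  have t_lim: "(\<lambda>k. t k j) \<longlonglongrightarrow> 0" for j
  proof (cases j)
    case 0
    then show ?thesis
      by (simp add: t_def eigen_seq_def)
  next
    case (Suc i)
    have "(\<lambda>k. y (k + i - i)) \<longlonglongrightarrow> w"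
      using ylim by simp
    then have "(\<lambda>k. y (k - i)) \<longlonglongrightarrow> w"
      by (rule LIMSEQ_offset)
    then have "(\<lambda>k. a ^ i *s (of_real (?b (k - i) / ?b k) *s y (k - i) - w)) \<longlonglongrightarrow> a ^ i *s (of_real 1 *s w - w)"
      by (intro tendsto_vector_scalar_mult tendsto_intros neg_binom_ratio_tendsto_1 assms(6))
    then have "(\<lambda>k. a ^ i *s (of_real (?b (k - i) / ?b k) *s y (k - i) - w)) \<longlonglongrightarrow> 0"
      by simp
    moreover have "eventually (\<lambda>k. a ^ i *s (of_real (?b (k - i) / ?b k) *s y (k - i) - w) = t k j) sequentially"
      using eventually_gt_at_top[of i] by eventually_elim (simp only: Suc t_eq)
    ultimately show ?thesis
      by (rule Lim_transform_eventually)
  qed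
  have M0: "0 \<le> M"
    using M[of 0] norm_ge_zero order.trans by blast
  have t_bound: "norm (t k (Suc i)) \<le> cmod a ^ i * (M + norm w)" for k i
  proof (cases "i < k")
    case True
    have "norm (of_real (?b (k - i) / ?b k) *s y (k - i)) \<le> 1 * M"
      unfolding norm_vector_scalar_mult
    proof (intro mult_mono M)
      show "cmod (of_real (?b (k - i) / ?b k)) \<le> 1"
        using neg_binom_mono[OF assms(6), of "k - i" k] b0[of k] b0[of "k - i"] by (simp add: norm_divide)
    qed auto
    then have "norm (of_real (?b (k - i) / ?b k) *s y (k - i) - w) \<le> M + norm w"
      using norm_triangle_ineq4[of "of_real (?b (k - i) / ?b k) *s y (k - i)" w] by linarith
    then show ?thesis
      unfolding t_eq[OF True] norm_vector_scalar_mult norm_power by (intro mult_left_mono) auto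
  next
    case False
    then have "norm (t k (Suc i)) = cmod a ^ i * norm w"
      by (simp add: t_def norm_eigen_seq_le mult.commute)
    also have "\<dots> \<le> cmod a ^ i * (M + norm w)"
      using M0 by (intro mult_left_mono) auto
    finally show ?thesis .
  qed
  define D where "D j = (if j = 0 then 0 else cmod a ^ (j - 1) * (M + norm w) / \<rho> ^ j)" for j
  have D_le: "norm (t k j) / \<rho> ^ j \<le> D j" for k j
    using t_bound[of k "j - 1"] assms(1)
    by (cases "j = 0") (auto simp: D_def t_def eigen_seq_def intro!: divide_right_mono)
  have "summable (\<lambda>i. (M + norm w) / \<rho> * (cmod a / \<rho>) ^ i)"
    using assms(1,5) by (intro summable_mult summable_geometric) auto
  then have "summable (\<lambda>i. D (Suc i))"
    by (simp add: D_def power_divide mult_ac)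
  then have D_sum: "summable D"
    by (subst (asm) summable_Suc_iff)
  note t_lp = lp_norm_dominated_convergence[OF assms(1,2) _ t_lim D_le D_sum]
  have t0: "t k 0 = 0" for k
    by (simp add: t_def eigen_seq_def)
  have split: "seq_scale (c k) ((companion_op iota ^^ k) u) - eigen_seq a w = t k + seq_scale (c k) (seq_shift k u)" for k
    by (rule ext)
      (simp add: seq_scale_def t_def seq_shift_def companion_pow_components[of u, OF u0])
  have c_le: "cmod (c k) \<le> cmod a ^ k" for k
    using b1[of k] b0[of k] by (simp add: c_def norm_divide norm_power divide_le_eq mult_left_le_one_le mult_le_cancel_left1)
  note shift_lp = lp_scale_le[OF assms(1,2) lp_shift(1)[OF assms(1-3)]]
  have shift_le: "lp_norm p \<rho> (seq_scale (c k) (seq_shift k u)) \<le> (cmod a / \<rho>) ^ k * lp_norm p \<rho> u" for k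
  proof -
    have "lp_norm p \<rho> (seq_scale (c k) (seq_shift k u)) \<le> cmod (c k) * lp_norm p \<rho> (seq_shift k u)"
      by (rule shift_lp(2))
    also have "\<dots> \<le> cmod a ^ k * (lp_norm p \<rho> u / \<rho> ^ k)"
      using c_le lp_shift(2)[OF assms(1-3)] lp_norm_nonneg[OF assms(1) lp_shift(1)[OF assms(1-3)]]
      by (intro mult_mono) auto
    finally show ?thesis
      by (simp add: power_divide)
  qed
  have "(\<lambda>k. (cmod a / \<rho>) ^ k) \<longlonglongrightarrow> 0"
    using assms(1,5) by (intro LIMSEQ_power_zero) simp
  then have "(\<lambda>k. lp_norm p \<rho> (t k) + (cmod a / \<rho>) ^ k * lp_norm p \<rho> u) \<longlonglongrightarrow> 0 + 0 * lp_norm p \<rho> u"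
    by (intro tendsto_add tendsto_mult t_lp(2) t0 tendsto_const)
  then have upper: "(\<lambda>k. lp_norm p \<rho> (t k) + (cmod a / \<rho>) ^ k * lp_norm p \<rho> u) \<longlonglongrightarrow> 0"
    by simp
  have "lp_norm p \<rho> (t k + seq_scale (c k) (seq_shift k u)) \<le> lp_norm p \<rho> (t k) + (cmod a / \<rho>) ^ k * lp_norm p \<rho> u"
    and "0 \<le> lp_norm p \<rho> (t k + seq_scale (c k) (seq_shift k u))" for k
    using lp_add[OF assms(1,2) t_lp(1)[OF t0, of k] shift_lp(1), of "c k" k] shift_le[of k]
      lp_norm_nonneg[OF assms(1)]
    by (force intro: order.trans)+
  then have "(\<lambda>k. lp_norm p \<rho> (t k + seq_scale (c k) (seq_shift k u))) \<longlonglongrightarrow> 0"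
    by (intro tendsto_sandwich[OF _ _ tendsto_const upper] always_eventually allI) auto
  then show ?thesis
    by (simp only: split flip: c_def)
qed

theorem proposition3p1:
  fixes iota :: "nat \<Rightarrow> complex^'n^'n" and R p :: ereal and \<rho> :: real and lam0 :: complex
  assumes "R = conv_radius iota" and "0 < R"
    and "invertible (iota 0)"
    and "spectral_value iota lam0"
    and "\<And>z. spectral_value iota z \<Longrightarrow> z \<noteq> lam0 \<Longrightarrow> cmod lam0 < cmod z"
    and "ereal (cmod lam0) < R"
    and "1 \<le> p"
    and "cmod lam0 < \<rho>" and "ereal \<rho> < R"
  shows "(\<exists>\<delta>>0. pencil_inv_analytic_on iota {z. cmod z < cmod lam0 + \<delta> \<and> z \<noteq> lam0}) \<and>
    (\<forall>u \<in> lp_space p \<rho>.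
       summable (\<lambda>k. iota (Suc k) *v u (Suc k)) \<and> companion_op iota u \<in> lp_space p \<rho>) \<and>
    (\<exists>W V. cseq.subspace W \<and> W \<subset> lp_space p \<rho> \<and> V = lp_space p \<rho> - W \<and>
       (\<forall>u0 \<in> V. \<exists>ustar \<in> lp_space p \<rho>.
          ustar \<noteq> 0 \<and>
          (\<lambda>k. lp_norm p \<rho>
             (seq_scale ((sgn lam0) ^ k / of_real (lp_norm p \<rho> ((companion_op iota ^^ k) u0)))
                ((companion_op iota ^^ k) u0) - ustar)) \<longlonglongrightarrow> 0 \<and>
          companion_op iota ustar = seq_scale (inverse lam0) ustar \<and>
          pencil iota lam0 *v ustar 1 = 0) \<and>
       (\<exists>W0 V0. vec.subspace W0 \<and> W0 \<subset> UNIV \<and> V0 = UNIV - W0 \<and>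
          (\<forall>v \<in> V0. (\<lambda>j. if j = 1 then v else 0) \<in> V)))"
proof -
  let ?P = "pencil iota" and ?X = "lp_space p \<rho>" and ?A = "companion_op iota"
  have \<rho>R: "ereal \<rho> < conv_radius iota"
    using assms(1,9) by simp
  have \<rho>0: "0 < \<rho>"
    using assms(8) norm_ge_zero[of lam0] by linarith
  have det0: "det (?P lam0) = 0"
    using assms(4) by (simp add: spectral_value_iff_det)
  have lam0: "lam0 \<noteq> 0"
    using det0 assms(3) by (auto simp: pencil_0 invertible_det_nz)
  obtain \<delta> where \<delta>: "0 < \<delta>" "cmod lam0 + \<delta> \<le> \<rho>"
      "\<And>z. cmod z < cmod lam0 + \<delta> \<Longrightarrow> z \<noteq> lam0 \<Longrightarrow> det (?P z) \<noteq> 0"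
    using isolated_smallest_spectral_value[OF assms(3,4,5,8) \<rho>R] by blast
  define S where "S = ball (0 :: complex) (cmod lam0 + \<delta>)"
  have "ereal (cmod z) < conv_radius iota" if "z \<in> S" for z
    using that \<delta>(2) by (intro le_less_trans[OF _ \<rho>R]) (simp add: S_def)
  then have S: "open S" "connected S" "lam0 \<in> S" "S \<subseteq> eball 0 (conv_radius iota)"
    using \<delta>(1) by (auto simp: S_def)
  have analytic: "pencil_inv_analytic_on iota {z. cmod z < cmod lam0 + \<delta> \<and> z \<noteq> lam0}"
  proof -
    have eq: "{z. cmod z < cmod lam0 + \<delta> \<and> z \<noteq> lam0} = S - {lam0}"
      by (auto simp: S_def)
    show ?thesis
      unfolding eq using S \<delta>(3) by (intro pencil_inv_analytic_onI) (auto simp: S_def)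
  qed
  obtain m G where m: "0 < m" and G: "clears_pole iota S lam0 m G" "G lam0 \<noteq> 0"
    using pole_of_inverse[OF S det0] \<delta>(3) by (auto simp: S_def)
  \<comment> \<open>Here \<open>0 < m\<close> matters: the scalar \<open>(z - lam0)^m\<close> vanishes at \<open>lam0\<close>.\<close>
  have GP: "G lam0 ** ?P lam0 = 0" and PG: "?P lam0 ** G lam0 = 0"
    using G(1) S(3) m by (auto simp: clears_pole_def mat_def vec_eq_iff)

  \<comment> \<open>The limit of the rescaled first entries; the exceptional subspace is its kernel.\<close>
  define L where "L u = (- 1 / (- lam0) ^ m) *s (G lam0 *v forcing_val iota u lam0)" for u
  define c where "c k = lam0 ^ k / of_real (neg_binom m k)" for k
  have asym: "(\<lambda>k. c k *s (?A ^^ k) u 1) \<longlonglongrightarrow> L u" if "u \<in> ?X" for u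
    unfolding c_def L_def
    by (rule companion_iterates_asymptotics[OF \<rho>0 assms(7) \<rho>R that assms(3) _ \<delta>(2) lam0 m G(1)[unfolded S_def]])
      (use \<delta>(1) in simp)
  \<comment> \<open>Linearity is inherited from the iterates through the limit.\<close>
  have L_add: "L (u + v) = L u + L v" if "u \<in> ?X" "v \<in> ?X" for u v
  proof (rule LIMSEQ_unique[OF asym[OF lp_add(1)[OF \<rho>0 assms(7) that]]])
    show "(\<lambda>k. c k *s (?A ^^ k) (u + v) 1) \<longlonglongrightarrow> L u + L v"
      using tendsto_add[OF asym[OF that(1)] asym[OF that(2)]]
      by (simp add: companion_pow_add[OF \<rho>0 assms(7) \<rho>R that] vector_add_ldistrib)
  qed
  have L_scale: "L (seq_scale d u) = d *s L u" if "u \<in> ?X" for d u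
  proof (rule LIMSEQ_unique[OF asym[OF lp_scale_le(1)[OF \<rho>0 assms(7) that]]])
    have "c k *s (?A ^^ k) (seq_scale d u) 1 = d *s (c k *s (?A ^^ k) u 1)" for k
      unfolding companion_pow_scale[OF \<rho>0 assms(7) \<rho>R that] by (simp add: seq_scale_def mult.commute)
    then show "(\<lambda>k. c k *s (?A ^^ k) (seq_scale d u) 1) \<longlonglongrightarrow> d *s L u"
      using tendsto_vector_scalar_mult[OF tendsto_const asym[OF that], of d] by (simp only:)
  qed
  have P_L: "?P lam0 *v L u = 0" for u
    by (simp add: L_def vector_scalar_commute matrix_vector_mult_neg matrix_vector_mul_assoc PG)

  define W where "W = {u \<in> ?X. L u = 0}"
  have W_subspace: "cseq.subspace W"
  proof (rule cseq.subspaceI)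
    have "L (seq_scale 0 0) = 0"
      by (simp only: L_scale[OF lp_space_zero] vector_smult_lzero)
    then show "0 \<in> W"
      using lp_space_zero by (simp add: W_def)
  qed (auto simp: W_def L_add L_scale lp_add(1)[OF \<rho>0 assms(7)] lp_scale_le(1)[OF \<rho>0 assms(7)])

  let ?e = "\<lambda>v :: complex^'n. (\<lambda>j :: nat. if j = 1 then v else 0)"
  define W0 where "W0 = {v. G lam0 *v (iota 0 *v v) = 0}"
  have W0_subspace: "vec.subspace W0"
    by (rule vec.subspaceI) (auto simp: W0_def matrix_vector_right_distrib vector_scalar_commute)
  have "W0 \<noteq> UNIV"
  proof
    assume "W0 = UNIV"
    then have "G lam0 *v (iota 0 *v (matrix_inv (iota 0) *v x)) = 0" for x
      by (auto simp: W0_def)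
    then have "G lam0 *v x = 0 *v x" for x
      using matrix_inv_props(1)[OF assms(3)] by (simp add: matrix_vector_mul_assoc)
    then show False
      using G(2) by (simp add: matrix_eq)
  qed
  have e_mem: "?e v \<in> ?X - W" if "v \<notin> W0" for v
  proof -
    have "forcing_val iota (?e v) lam0 = (?P lam0 - iota 0) *v v"
      using assms(1,6) by (intro forcing_val_single) simp
    then have "G lam0 *v forcing_val iota (?e v) lam0 = - (G lam0 *v (iota 0 *v v))"
      using GP by (simp only: matrix_vector_mult_diff_rdistrib matrix_vector_mult_diff_distrib
          matrix_vector_mul_assoc) simp
    then have "L (?e v) \<noteq> 0"
      using that lam0 by (auto simp: L_def W0_def)
    then show ?thesis
      using lp_single[OF \<rho>0 assms(7)] by (simp add: W_def)
  qed
  have W_proper: "W \<subset> ?X"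
  proof -
    obtain v where "v \<notin> W0"
      using \<open>W0 \<noteq> UNIV\<close> by blast
    then have "?X - W \<noteq> {}"
      using e_mem by (metis empty_iff)
    then have "W \<noteq> ?X"
      by blast
    then show ?thesis
      by (auto simp: W_def)
  qed

  have conv: "\<exists>ustar \<in> ?X. ustar \<noteq> 0 \<and>
      (\<lambda>k. lp_norm p \<rho> (seq_scale ((sgn lam0) ^ k / of_real (lp_norm p \<rho> ((?A ^^ k) u0)))
         ((?A ^^ k) u0) - ustar)) \<longlonglongrightarrow> 0 \<and>
      ?A ustar = seq_scale (inverse lam0) ustar \<and> ?P lam0 *v ustar 1 = 0" if "u0 \<in> ?X - W" for u0
  proof -
    have u0: "u0 \<in> ?X" "L u0 \<noteq> 0"
      using that by (auto simp: W_def)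
    let ?U = "eigen_seq lam0 (L u0)" and ?x = "\<lambda>k. (?A ^^ k) u0"
    have U: "?U \<in> ?X"
      by (rule eigen_seq_in_lp[OF \<rho>0 assms(7,8)])
    have "?U 1 \<noteq> 0"
      using u0(2) by (simp add: eigen_seq_def)
    then have "?U \<noteq> 0"
      by (metis zero_fun_apply)
    define d where "d = 1 / complex_of_real (lp_norm p \<rho> ?U)"
    have d: "d \<noteq> 0"
      using lp_norm_eq_0_imp[OF \<rho>0 assms(7) U] \<open>?U \<noteq> 0\<close> by (auto simp: d_def)
    have x: "?x k \<in> ?X" for k
      by (rule companion_pow_in_lp[OF \<rho>0 assms(7) u0(1)])
    have z_lim: "(\<lambda>k. lp_norm p \<rho> (seq_scale (c k) (?x k) - ?U)) \<longlonglongrightarrow> 0"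
      unfolding c_def
      by (rule companion_iterates_lp_limit[OF \<rho>0 assms(7) u0(1) lam0 assms(8) m])
        (use asym[OF u0(1)] in \<open>simp add: c_def\<close>)
    \<comment> \<open>The scalar \<open>c k\<close> has the phase of \<open>lam0 ^ k\<close>, because its denominator is positive.\<close>
    have phase: "seq_scale (1 / of_real (lp_norm p \<rho> (seq_scale (c k) (?x k)))) (seq_scale (c k) (?x k))
        = seq_scale ((sgn lam0) ^ k / of_real (lp_norm p \<rho> (?x k))) (?x k)" for k
    proof -
      have "0 < neg_binom m k"
        using neg_binom_ge_1[OF m, of k] by linarith
      then have "c k / of_real (cmod (c k)) = sgn lam0 ^ k"
        by (simp add: c_def norm_divide norm_power sgn_eq power_divide)
      then have "1 / of_real (cmod (c k) * lp_norm p \<rho> (?x k)) * c k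
          = (sgn lam0) ^ k / of_real (lp_norm p \<rho> (?x k))"
        by (metis divide_divide_eq_left of_real_mult times_divide_eq_left mult_1)
      then show ?thesis
        by (simp only: lp_norm_scale[OF \<rho>0 assms(7) x] cseq.scale_scale)
    qed
    have "(\<lambda>k. lp_norm p \<rho> (seq_scale (1 / of_real (lp_norm p \<rho> (seq_scale (c k) (?x k)))) (seq_scale (c k) (?x k))
        - seq_scale d ?U)) \<longlonglongrightarrow> 0"
      unfolding d_def
      by (rule lp_normalise_convergent[OF \<rho>0 assms(7) lp_scale_le(1)[OF \<rho>0 assms(7) x] U \<open>?U \<noteq> 0\<close> z_lim])
    then have lim: "(\<lambda>k. lp_norm p \<rho> (seq_scale ((sgn lam0) ^ k / of_real (lp_norm p \<rho> (?x k))) (?x k)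
        - seq_scale d ?U)) \<longlonglongrightarrow> 0"
      by (simp only: phase)
    have "?A ?U = seq_scale (inverse lam0) ?U"
      using assms(1,3,6) lam0 P_L by (intro eigen_seq_eigenvector) auto
    then have eig: "?A (seq_scale d ?U) = seq_scale (inverse lam0) (seq_scale d ?U)"
      by (simp add: companion_op_scale[OF \<rho>0 assms(7) \<rho>R U] mult.commute)
    have "?P lam0 *v seq_scale d ?U 1 = 0"
      by (simp add: seq_scale_def eigen_seq_def vector_scalar_commute P_L)
    moreover have "seq_scale d ?U \<noteq> 0"
      using d \<open>?U \<noteq> 0\<close> by simp
    ultimately show ?thesis
      using lp_scale_le(1)[OF \<rho>0 assms(7) U, of d] lim eig by blast
  qed

  show ?thesis
  proof (intro conjI ballI)
    show "\<exists>\<delta>>0. pencil_inv_analytic_on iota {z. cmod z < cmod lam0 + \<delta> \<and> z \<noteq> lam0}"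
      using \<delta>(1) analytic by blast
    show "summable (\<lambda>k. iota (Suc k) *v u (Suc k))" "?A u \<in> ?X" if "u \<in> ?X" for u
      using that by (rule companion_summable[OF \<rho>0 assms(7) \<rho>R], rule companion_op_in_lp[OF \<rho>0 assms(7)])
  next
    show "\<exists>W V. cseq.subspace W \<and> W \<subset> ?X \<and> V = ?X - W \<and>
       (\<forall>u0 \<in> V. \<exists>ustar \<in> ?X. ustar \<noteq> 0 \<and>
          (\<lambda>k. lp_norm p \<rho> (seq_scale ((sgn lam0) ^ k / of_real (lp_norm p \<rho> ((?A ^^ k) u0)))
                ((?A ^^ k) u0) - ustar)) \<longlonglongrightarrow> 0 \<and>
          ?A ustar = seq_scale (inverse lam0) ustar \<and> ?P lam0 *v ustar 1 = 0) \<and>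
       (\<exists>W0 V0. vec.subspace W0 \<and> W0 \<subset> UNIV \<and> V0 = UNIV - W0 \<and> (\<forall>v \<in> V0. ?e v \<in> V))"
    proof (rule exI[of _ W], rule exI[of _ "?X - W"], intro conjI ballI)
      show "\<exists>W0 V0. vec.subspace W0 \<and> W0 \<subset> UNIV \<and> V0 = UNIV - W0 \<and> (\<forall>v \<in> V0. ?e v \<in> ?X - W)"
      proof (rule exI[of _ W0], rule exI[of _ "UNIV - W0"], intro conjI ballI)
        show "W0 \<subset> UNIV"
          using \<open>W0 \<noteq> UNIV\<close> by blast
        show "?e v \<in> ?X - W" if "v \<in> UNIV - W0" for v
          using that by (intro e_mem) simp
      qed (rule W0_subspace refl)+
    qed (rule W_subspace W_proper refl conv | assumption)+
  qed
qed

end
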